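(* For every integer $m\ge 3$, the Ehrhart polynomial of the parking function polytope $P_m$ is magic positive.
   Context: A parking function of length $m$ is an $m$-vector of positive integers whose nondecreasing rearrangement $a_1\le a_2\le\cdots\le a_m$ satisfies $a_i\le i$ for $i=1,\ldots,m$. The parking function polytope $P_m\subset\mathbb{R}^m$ is the convex hull of all parking functions of length $m$ (for $m\ge 2$ it is an $m$-dimensional lattice polytope). For a lattice polytope $\mathcal{P}\subset\mathbb{R}^N$ of dimension $d$, the Ehrhart polynomial $i(\mathcal{P},t)$ is the polynomial in $t$ satisfying $i(\mathcal{P},t)=|t\mathcal{P}\cap\mathbb{Z}^N|$ for all positive integers $t$; it has degree $d$. It is called magic positive if $i(\mathcal{P},t)=\sum_{i=0}^d a_i\,t^i(t+1)^{d-i}$ with $a_i\ge 0$ for all $0\le i\le d$. *)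

theory Defs
  imports "HOL-Analysis.Analysis" "HOL-Computational_Algebra.Polynomial" "HOL-Library.Multiset"
begin

text \<open>
  Vectors of length m are indexed by a finite type \<open>'n\<close> with \<open>CARD('n) = m\<close>. The index type carries
  no order, which is harmless because parking functions are invariant under permuting coordinates.
\<close>

definition nondecreasing_rearrangement :: "nat ^ 'n \<Rightarrow> nat list" where
  "nondecreasing_rearrangement f = sorted_list_of_multiset (image_mset (\<lambda>j. f $ j) (mset_set UNIV))"

text \<open>List positions start at 0, so the condition \<open>a\<^sub>i \<le> i\<close> becomes \<open>a ! i \<le> i + 1\<close>.\<close>

definition parking_function :: "nat ^ 'n \<Rightarrow> bool" where
  "parking_function f \<longleftrightarrow>
     (\<forall>j. f $ j \<ge> 1) \<and> (\<forall>i < CARD('n). nondecreasing_rearrangement f ! i \<le> i + 1)"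

definition parking_function_polytope :: "(real ^ 'n) set" where
  "parking_function_polytope = convex hull {(\<chi> j. real (f $ j)) | f. parking_function f}"

definition integer_lattice :: "(real ^ 'n) set" where
  "integer_lattice = {x. \<forall>j. x $ j \<in> \<int>}"

definition is_ehrhart_polynomial :: "(real ^ 'n) set \<Rightarrow> real poly \<Rightarrow> bool" where
  "is_ehrhart_polynomial P p \<longleftrightarrow>
     (\<forall>t::nat. t \<ge> 1 \<longrightarrow> poly p (real t) = real (card ((\<lambda>x. real t *\<^sub>R x) ` P \<inter> integer_lattice)))"

lemma is_ehrhart_polynomial_unique:
  assumes "is_ehrhart_polynomial P p" "is_ehrhart_polynomial P q"
  shows "p = q"
proof (rule ccontr)
  assume "p \<noteq> q"
  then have "finite {x. poly (p - q) x = 0}"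
    by (intro poly_roots_finite) simp
  moreover have "real ` {1..} \<subseteq> {x. poly (p - q) x = 0}"
    using assms by (auto simp: is_ehrhart_polynomial_def)
  ultimately have "finite (real ` {1..})"
    using finite_subset by blast
  then have "finite {1::nat..}"
    by (rule finite_imageD) (simp add: inj_on_def)
  then show False
    by (simp add: infinite_Ici)
qed

definition magic_positive :: "nat \<Rightarrow> real poly \<Rightarrow> bool" where
  "magic_positive d p \<longleftrightarrow>
     (\<exists>a :: nat \<Rightarrow> real. (\<forall>i\<le>d. a i \<ge> 0) \<and>
        p = (\<Sum>i\<le>d. smult (a i) ([:0, 1:] ^ i * [:1, 1:] ^ (d - i))))"

end

theory Submission imports Defs begin

text \<open>
  Shifted by the all-ones vector, the parking function polytope is the polymatroid of the
  complete graph on \<open>m\<close> vertices: its points are the nonnegative vectors whose sum over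
  each set of vertices is at most the number of edges meeting that set
  (\<open>mem_parking_function_polytope_iff\<close>). Hence the lattice points of the \<open>t\<close>-th dilate
  are the ways to demand edge ends at the vertices that can be met by \<open>t\<close> copies of each
  edge, every edge serving at most one of its ends.

  To count them, a vertex \<open>w\<close> is removed, its edges being left behind as loops at the
  other vertices. The number of possible demands at \<open>w\<close>, given the other demands, falls
  short of its maximum by the excess of the other demands, that is, the number of units
  that cannot be met without the edges to \<open>w\<close>. So one needs the sum of the excesses over
  all lattice points. As a function of the numbers of loops, this sum satisfies a
  first-order difference equation whose right-hand side involves the same sums for one
  vertex less, and its solution is a quadratic form (\<open>card_demands_and_excess_sum\<close>). The
  resulting recursion for the counts is the differential equation of a generating
  function: the number of lattice points is \<open>m!\<close> times the coefficient of \<open>v ^ m\<close> in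
  \<open>sqrt (1 - t v) exp ((1 + (m - 1/2) t) v - t v\<^sup>2 / 4)\<close>
  (\<open>lattice_count_eq_count_fps\<close>).

  Splitting off \<open>exp ((1 + t) (v - t v\<^sup>2 / 4))\<close> and expanding it in powers of
  \<open>1 + t\<close> exhibits the coefficients in the magic basis: up to positive factors, the one
  of \<open>t ^ n (1 + t) ^ j\<close> with \<open>j + n = m\<close> is the coefficient of \<open>u ^ n\<close> in
  \<open>(1 - u / 4) ^ j sqrt (1 - u) exp ((m - 3/2) u + u\<^sup>2 / 4)\<close>
  (\<open>count_fps_expansion\<close>). These are nonnegative for \<open>m \<ge> 3\<close>
  (\<open>kernel_coefficient_nonneg\<close>), since the exponential grows fast enough up to index
  \<open>n \<le> m\<close> to outweigh the few negative coefficients of the other factors.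
\<close>

notation fps_nth (infixl "$$" 75)

section \<open>Lattice points of the polymatroid of a complete graph with loops\<close>

text \<open>
  The number of edges of the complete graph on \<open>n\<close> vertices that meet a given set of \<open>k\<close>
  vertices, counted by removing the \<open>k\<close> vertices one after the other.
\<close>

definition edges_meeting :: "nat \<Rightarrow> nat \<Rightarrow> int" where
  "edges_meeting n k = (\<Sum>i<k. int n - 1 - int i)"

lemma edges_meeting_0 [simp]: "edges_meeting n 0 = 0"
  by (simp add: edges_meeting_def)

lemma two_edges_meeting: "2 * edges_meeting n k = int k * (2 * int n - int k - 1)"
  by (induction k) (auto simp: edges_meeting_def algebra_simps)

lemma edges_meeting_Suc_left: "edges_meeting (Suc n) k = edges_meeting n k + int k"
  using two_edges_meeting[of "Suc n" k] two_edges_meeting[of n k] by (simp add: algebra_simps)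

lemma edges_meeting_Suc_Suc: "edges_meeting (Suc n) (Suc k) = edges_meeting n k + int n"
  using two_edges_meeting[of "Suc n" "Suc k"] two_edges_meeting[of n k] by (simp add: algebra_simps)

text \<open>
  Every edge that meets \<open>A \<inter> B\<close> is counted twice on both sides, so only edges
  between \<open>A - B\<close> and \<open>B - A\<close> make a difference, and these are lost on the left.
\<close>

lemma edges_meeting_submodular:
  assumes "finite A" "finite B"
  shows "edges_meeting n (card (A \<union> B)) + edges_meeting n (card (A \<inter> B)) \<le> edges_meeting n (card A) + edges_meeting n (card B)"
proof -
  define x where "x = card (A \<inter> B)"
  define u where "u = card (A - B)"
  define v where "v = card (B - A)"
  have A: "card A = x + u"
    unfolding x_def u_def using card_Int_Diff[OF assms(1), of B] .
  have B: "card B = x + v"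
    unfolding x_def v_def using card_Int_Diff[OF assms(2), of A] by (simp add: Int_commute)
  have U: "card (A \<union> B) = x + u + v"
    using card_Un_Int[OF assms] A B x_def by simp
  define z where "z = edges_meeting n (x + u) + edges_meeting n (x + v) - edges_meeting n (x + u + v) - edges_meeting n x"
  have "2 * z = 2 * (int u * int v)"
    using two_edges_meeting[of n "x+u"] two_edges_meeting[of n "x+v"] two_edges_meeting[of n "x+u+v"] two_edges_meeting[of n x]
    by (simp add: z_def algebra_simps)
  then have "0 \<le> z" by simp
  then have "edges_meeting n (x + u + v) + edges_meeting n x \<le> edges_meeting n (x + u) + edges_meeting n (x + v)"
    unfolding z_def by linarith
  then show ?thesis
    unfolding A B U x_def[symmetric] .
qed

text \<open>
  The graph is the complete graph on \<open>V\<close> with every edge taken \<open>t\<close> times and \<open>\<kappa> x\<close>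
  loops at the vertex \<open>x\<close>. The excess of a demand \<open>r\<close> is the largest amount by which the
  demand of some set of vertices exceeds the number of edges and loops that meet it. By
  Hall's theorem it is the number of units of demand that cannot be served when each edge
  serves one unit at one of its ends; it is \<open>0\<close> exactly for the lattice points of the
  polymatroid of the graph.
\<close>

definition excess_on :: "int \<Rightarrow> 'a set \<Rightarrow> ('a \<Rightarrow> int) \<Rightarrow> ('a \<Rightarrow> nat) \<Rightarrow> 'a set \<Rightarrow> int" where
  "excess_on t V \<kappa> r R = (\<Sum>x\<in>R. int (r x) - \<kappa> x) - t * edges_meeting (card V) (card R)"

definition excess :: "int \<Rightarrow> 'a set \<Rightarrow> ('a \<Rightarrow> int) \<Rightarrow> ('a \<Rightarrow> nat) \<Rightarrow> int" where
  "excess t V \<kappa> r = Max (excess_on t V \<kappa> r ` Pow V)"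

lemma excess_ge: "finite V \<Longrightarrow> R \<subseteq> V \<Longrightarrow> excess_on t V \<kappa> r R \<le> excess t V \<kappa> r"
  unfolding excess_def by (intro Max_ge) auto

lemma excess_attained:
  assumes "finite V"
  obtains R where "R \<subseteq> V" "excess t V \<kappa> r = excess_on t V \<kappa> r R"
proof -
  have "excess t V \<kappa> r \<in> excess_on t V \<kappa> r ` Pow V"
    unfolding excess_def using assms by (intro Max_in) auto
  then show ?thesis using that by auto
qed

lemma excess_le_iff:
  "finite V \<Longrightarrow> excess t V \<kappa> r \<le> b \<longleftrightarrow> (\<forall>R\<subseteq>V. excess_on t V \<kappa> r R \<le> b)"
  unfolding excess_def by (subst Max_le_iff) auto

lemma excess_nonneg: "finite V \<Longrightarrow> 0 \<le> excess t V \<kappa> r"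
  using excess_ge[of V "{}" t \<kappa> r] by (simp add: excess_on_def)

lemma excess_empty [simp]: "excess t {} \<kappa> r = 0"
  by (simp add: excess_def excess_on_def)

lemma excess_on_cong:
  "(\<And>x. x \<in> V \<Longrightarrow> \<kappa> x = \<kappa>' x) \<Longrightarrow> (\<And>x. x \<in> V \<Longrightarrow> r x = r' x) \<Longrightarrow> R \<subseteq> V \<Longrightarrow>
     excess_on t V \<kappa> r R = excess_on t V \<kappa>' r' R"
  unfolding excess_on_def by (intro arg_cong2[where f = minus] sum.cong) auto

lemma excess_cong:
  "(\<And>x. x \<in> V \<Longrightarrow> \<kappa> x = \<kappa>' x) \<Longrightarrow> (\<And>x. x \<in> V \<Longrightarrow> r x = r' x) \<Longrightarrow>
     excess t V \<kappa> r = excess t V \<kappa>' r'"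
  unfolding excess_def by (intro arg_cong[where f = Max] image_cong refl excess_on_cong) auto

lemma excess_on_shift:
  "excess_on t V (\<lambda>x. \<kappa> x + d) r R = excess_on t V \<kappa> r R - int (card R) * d"
  unfolding excess_on_def by (simp add: sum_subtractf sum.distrib algebra_simps)

lemma excess_le_excess_shift:
  assumes "finite V" "0 \<le> d"
  shows "excess t V \<kappa> r \<le> excess t V (\<lambda>x. \<kappa> x + d) r + d * int (card V)"
  unfolding excess_le_iff[OF assms(1)]
proof (intro allI impI)
  fix R assume R: "R \<subseteq> V"
  have "int (card R) * d \<le> d * int (card V)"
    using card_mono[OF assms(1) R] assms(2) by (simp add: mult.commute mult_left_mono)
  with excess_ge[OF assms(1) R, of t "\<lambda>x. \<kappa> x + d" r]
  show "excess_on t V \<kappa> r R \<le> excess t V (\<lambda>x. \<kappa> x + d) r + d * int (card V)"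
    unfolding excess_on_shift by linarith
qed

text \<open>
  A set of vertices of the larger graph either avoids \<open>w\<close>, and then the \<open>t\<close> edges from
  each vertex to \<open>w\<close> act as \<open>t\<close> additional loops, or it contains \<open>w\<close>, and then all the
  edges at \<open>w\<close> are counted once. This dichotomy is what makes the whole count recursive:
  removing a vertex leads back to a complete graph, with more loops.
\<close>

lemma excess_insert:
  assumes "finite V" "w \<notin> V"
  shows "excess t (insert w V) \<kappa> r =
    max (excess t V (\<lambda>x. \<kappa> x + t) r) (int (r w) - \<kappa> w - t * int (card V) + excess t V \<kappa> r)"
proof -
  have 1: "excess_on t (insert w V) \<kappa> r R = excess_on t V (\<lambda>x. \<kappa> x + t) r R" if "R \<subseteq> V" for R
    using assms unfolding excess_on_shift by (simp add: excess_on_def edges_meeting_Suc_left algebra_simps)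
  have 2: "excess_on t (insert w V) \<kappa> r (insert w R) =
      int (r w) - \<kappa> w - t * int (card V) + excess_on t V \<kappa> r R" if "R \<subseteq> V" for R
  proof -
    have "finite R" "w \<notin> R" using that assms finite_subset by auto
    then show ?thesis using assms by (simp add: excess_on_def edges_meeting_Suc_Suc algebra_simps)
  qed
  show ?thesis
  proof (rule antisym)
    show "excess t (insert w V) \<kappa> r \<le>
      max (excess t V (\<lambda>x. \<kappa> x + t) r) (int (r w) - \<kappa> w - t * int (card V) + excess t V \<kappa> r)"
    proof (subst excess_le_iff, (use assms in simp), intro allI impI)
      fix R assume R: "R \<subseteq> insert w V"
      show "excess_on t (insert w V) \<kappa> r R \<le>
        max (excess t V (\<lambda>x. \<kappa> x + t) r) (int (r w) - \<kappa> w - t * int (card V) + excess t V \<kappa> r)"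
      proof (cases "w \<in> R")
        case False
        then have "R \<subseteq> V" using R by auto
        then show ?thesis using 1 excess_ge[OF assms(1)] by (metis max.coboundedI1)
      next
        case True
        define R' where "R' = R - {w}"
        have "R' \<subseteq> V" "R = insert w R'" using True R by (auto simp: R'_def)
        then show ?thesis using 2[of R'] excess_ge[OF assms(1) \<open>R' \<subseteq> V\<close>, of t \<kappa> r]
          by simp
      qed
    qed
    obtain R where R: "R \<subseteq> V" "excess t V (\<lambda>x. \<kappa> x + t) r = excess_on t V (\<lambda>x. \<kappa> x + t) r R"
      using excess_attained[OF assms(1)] by blast
    obtain S where S: "S \<subseteq> V" "excess t V \<kappa> r = excess_on t V \<kappa> r S"
      using excess_attained[OF assms(1)] by blast
    have "excess_on t (insert w V) \<kappa> r R \<le> excess t (insert w V) \<kappa> r"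
         "excess_on t (insert w V) \<kappa> r (insert w S) \<le> excess t (insert w V) \<kappa> r"
      using assms R(1) S(1) by (intro excess_ge; auto)+
    with 1[OF R(1)] 2[OF S(1)] R(2) S(2)
    show "max (excess t V (\<lambda>x. \<kappa> x + t) r) (int (r w) - \<kappa> w - t * int (card V) + excess t V \<kappa> r)
      \<le> excess t (insert w V) \<kappa> r" by simp
  qed
qed

definition demands :: "int \<Rightarrow> 'a set \<Rightarrow> int \<Rightarrow> ('a \<Rightarrow> nat) set" where
  "demands t V c = {r. (\<forall>x. x \<notin> V \<longrightarrow> r x = 0) \<and> excess t V (\<lambda>_. c) r = 0}"

lemma demands_empty: "demands t {} c = {\<lambda>_. 0}"
  by (auto simp: demands_def)

text \<open>
  Fibres over the vertex \<open>w\<close>: a lattice point of the smaller graph extends by all demands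
  at \<open>w\<close> from \<open>0\<close> up to the number of edges and loops at \<open>w\<close>, lowered by the excess that
  the smaller point has when the edges to \<open>w\<close> are not available to it.
\<close>

lemma demands_insert:
  assumes "finite V" "w \<notin> V" "0 \<le> t" "0 \<le> c"
  shows "bij_betw (\<lambda>(r, k). r(w := k))
    (SIGMA r:demands t V (c + t). {..nat (c + t * int (card V) - excess t V (\<lambda>_. c) r)})
    (demands t (insert w V) c)"
proof (rule bij_betw_byWitness[where f' = "\<lambda>r. (r(w := 0), r w)"])
  have cong: "excess t V \<kappa> (r(w := k)) = excess t V \<kappa> r" for r k \<kappa>
    using assms(2) by (intro excess_cong) auto
  have nn: "0 \<le> c + t * int (card V) - excess t V (\<lambda>_. c) r" if "r \<in> demands t V (c + t)" for r
    using excess_le_excess_shift[OF assms(1,3), of t "\<lambda>_. c" r] that assms(4)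
    by (simp add: demands_def)
  have mem: "excess t (insert w V) (\<lambda>_. c) r = 0 \<longleftrightarrow> excess t V (\<lambda>_. c + t) r = 0 \<and>
     int (r w) \<le> c + t * int (card V) - excess t V (\<lambda>_. c) r" for r
    using excess_insert[OF assms(1,2), of t "\<lambda>_. c" r] excess_nonneg[OF assms(1), of t "\<lambda>_. c + t" r]
    by (auto simp: max_def)
  show "\<forall>a\<in>SIGMA r:demands t V (c + t). {..nat (c + t * int (card V) - excess t V (\<lambda>_. c) r)}.
       (\<lambda>r. (r(w := 0), r w)) ((\<lambda>(r, k). r(w := k)) a) = a"
    using assms(2) by (auto simp: demands_def fun_eq_iff)
  show "\<forall>a'\<in>demands t (insert w V) c. (\<lambda>(r, k). r(w := k)) ((\<lambda>r. (r(w := 0), r w)) a') = a'"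
    by simp
  show "(\<lambda>(r, k). r(w := k)) ` (SIGMA r:demands t V (c + t). {..nat (c + t * int (card V) - excess t V (\<lambda>_. c) r)})
    \<subseteq> demands t (insert w V) c"
  proof clarsimp
    fix r k assume r: "r \<in> demands t V (c + t)" and k: "k \<le> nat (c + t * int (card V) - excess t V (\<lambda>_. c) r)"
    have "int k \<le> c + t * int (card V) - excess t V (\<lambda>_. c) r" using k nn[OF r] by linarith
    then show "r(w := k) \<in> demands t (insert w V) c"
      using r unfolding demands_def by (auto simp: mem cong)
  qed
  show "(\<lambda>r. (r(w := 0), r w)) ` demands t (insert w V) c \<subseteq>
    (SIGMA r:demands t V (c + t). {..nat (c + t * int (card V) - excess t V (\<lambda>_. c) r)})"
    unfolding demands_def by (auto simp: mem cong le_nat_iff)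
qed

lemma finite_demands:
  assumes "finite V" "0 \<le> t" "0 \<le> c"
  shows "finite (demands t V c)"
  using assms
proof (induction V arbitrary: c rule: finite_induct)
  case empty
  then show ?case by (simp add: demands_empty)
next
  case (insert w V)
  have "finite (SIGMA r:demands t V (c + t). {..nat (c + t * int (card V) - excess t V (\<lambda>_. c) r)})"
    using insert by (intro finite_SigmaI) auto
  then show ?case
    using bij_betw_finite[OF demands_insert[OF insert.hyps insert.prems]] by simp
qed

lemma sum_demands_insert:
  fixes g :: "('a \<Rightarrow> nat) \<Rightarrow> 'b::comm_monoid_add"
  assumes "finite V" "w \<notin> V" "0 \<le> t" "0 \<le> c"
  shows "(\<Sum>r\<in>demands t (insert w V) c. g r) =
    (\<Sum>r\<in>demands t V (c + t). \<Sum>k\<le>nat (c + t * int (card V) - excess t V (\<lambda>_. c) r). g (r(w := k)))"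
proof -
  have "(\<Sum>r\<in>demands t (insert w V) c. g r) =
     (\<Sum>(r,k)\<in>(SIGMA r:demands t V (c + t). {..nat (c + t * int (card V) - excess t V (\<lambda>_. c) r)}). g (r(w := k)))"
    using sum.reindex_bij_betw[OF demands_insert[OF assms], of g] by (simp add: case_prod_unfold)
  also have "\<dots> = (\<Sum>r\<in>demands t V (c + t). \<Sum>k\<le>nat (c + t * int (card V) - excess t V (\<lambda>_. c) r). g (r(w := k)))"
    using finite_demands[OF assms(1,3), of "c + t"] assms(3,4) by (subst sum.Sigma) auto
  finally show ?thesis .
qed

text \<open>
  Adding loops in numbers \<open>t\<close> helps at least as much when there are fewer loops already.
  The proof is the usual exchange argument: the union of two maximising sets is tested
  against submodularity, and their intersection is harmless because \<open>r\<close> has no excess at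
  the level \<open>c + t\<close>. It is used to show that the threshold in the next lemma does not
  exceed the range of demands at \<open>w\<close>.
\<close>

lemma excess_exchange:
  assumes "finite V" "0 \<le> t" "r \<in> demands t V (c + t)" "\<And>x. x \<in> V \<Longrightarrow> \<kappa> x \<le> c"
  shows "excess t V (\<lambda>x. \<kappa> x + t) r + excess t V (\<lambda>_. c) r \<le> excess t V \<kappa> r"
proof -
  obtain R where R: "R \<subseteq> V" "excess t V (\<lambda>x. \<kappa> x + t) r = excess_on t V (\<lambda>x. \<kappa> x + t) r R"
    using excess_attained[OF assms(1)] by blast
  obtain S where S: "S \<subseteq> V" "excess t V (\<lambda>_. c) r = excess_on t V (\<lambda>_. c) r S"
    using excess_attained[OF assms(1)] by blast
  have fin: "finite R" "finite S" using R S assms(1) finite_subset by auto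
  have I: "excess_on t V (\<lambda>_. c + t) r (R \<inter> S) \<le> 0"
    using excess_ge[of V "R \<inter> S" t "\<lambda>_. c + t" r] assms R S by (auto simp: demands_def)
  have U: "excess_on t V \<kappa> r (R \<union> S) \<le> excess t V \<kappa> r"
    using R S assms by (intro excess_ge) auto
  define s where "s A = (\<Sum>x\<in>A. int (r x))" for A
  define kk where "kk A = (\<Sum>x\<in>A. \<kappa> x)" for A
  have s: "s (R \<union> S) = s R + s S - s (R \<inter> S)"
    unfolding s_def using sum.union_inter[OF fin, of "\<lambda>x. int (r x)"] by simp
  have k: "kk (R \<union> S) = kk R + kk (S - R)"
    unfolding kk_def using sum.union_disjoint[of R "S - R" \<kappa>] fin by (simp add: Un_Diff_cancel)
  have "kk (S - R) \<le> (\<Sum>x\<in>S-R. c)"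
    unfolding kk_def using assms(4) S by (intro sum_mono) auto
  moreover have "int (card (S - R)) = int (card S) - int (card (R \<inter> S))"
    using card_Diff_subset_Int[of S R] fin card_mono[of S "R \<inter> S"]
    by (simp add: Int_commute of_nat_diff)
  ultimately have kS: "kk (S - R) \<le> (int (card S) - int (card (R \<inter> S))) * c"
    by simp
  have "t * (edges_meeting (card V) (card (R \<union> S)) + edges_meeting (card V) (card (R \<inter> S))) \<le>
     t * (edges_meeting (card V) (card R) + edges_meeting (card V) (card S))"
    using edges_meeting_submodular[OF fin] assms(2) by (intro mult_left_mono)
  moreover have "t * int (card (R \<inter> S)) \<le> t * int (card R)"
    using fin assms(2) by (intro mult_left_mono) (auto intro: card_mono)
  ultimately show ?thesis
    using I U s k kS
    unfolding R(2) S(2) excess_on_shift unfolding excess_on_def sum_subtractf s_def[symmetric] kk_def[symmetric]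
    by (simp add: algebra_simps)
qed

lemma card_threshold:
  assumes "-1 \<le> h" "h \<le> int g"
  shows "(\<Sum>k\<le>g. if int k > h then 1 else 0 :: int) = int g - h"
proof -
  have "(\<Sum>k\<le>g. if int k > h then 1 else 0 :: int) = int (card {k\<in>{..g}. int k > h})"
    by (simp add: sum.If_cases Int_def)
  also have "{k\<in>{..g}. int k > h} = {nat (h + 1)..g}" using assms by auto
  finally show ?thesis using assms by simp
qed

text \<open>
  One more loop at \<open>w\<close> lowers the excess by one exactly for those demands at \<open>w\<close> above a
  threshold. The threshold and the upper end of the fibre both are expressed by excesses
  of the smaller graph, so the change of the total excess is a combination of three total
  excesses of the smaller graph.
\<close>

lemma excess_sum_increment:
  assumes "finite U" "w \<notin> U" "0 \<le> t" "\<And>x. x \<in> insert w U \<Longrightarrow> 0 \<le> \<kappa> x \<and> \<kappa> x \<le> c"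
  shows "(\<Sum>r\<in>demands t (insert w U) c. excess t (insert w U) \<kappa> r) -
         (\<Sum>r\<in>demands t (insert w U) c. excess t (insert w U) (\<kappa>(w := \<kappa> w + 1)) r) =
    (c - \<kappa> w) * int (card (demands t U (c + t)))
    - (\<Sum>r\<in>demands t U (c + t). excess t U (\<lambda>_. c) r)
    - (\<Sum>r\<in>demands t U (c + t). excess t U (\<lambda>x. \<kappa> x + t) r)
    + (\<Sum>r\<in>demands t U (c + t). excess t U \<kappa> r)"
proof -
  have c0: "0 \<le> c" using assms(4)[of w] by auto
  let ?g = "\<lambda>r. c + t * int (card U) - excess t U (\<lambda>_. c) r"
  have inner: "(\<Sum>k\<le>nat (?g r). excess t (insert w U) \<kappa> (r(w := k)) -
        excess t (insert w U) (\<kappa>(w := \<kappa> w + 1)) (r(w := k))) =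
      (c - \<kappa> w) - excess t U (\<lambda>_. c) r - excess t U (\<lambda>x. \<kappa> x + t) r + excess t U \<kappa> r"
    if r: "r \<in> demands t U (c + t)" for r
  proof -
    define a where "a = excess t U (\<lambda>x. \<kappa> x + t) r"
    define b where "b = excess t U \<kappa> r"
    \<comment> \<open>above this demand at \<open>w\<close>, every maximising set contains \<open>w\<close>\<close>
    define h where "h = \<kappa> w + t * int (card U) + a - b"
    have cong: "excess t U \<kappa>' (r(w := k)) = excess t U \<kappa>' r" for k \<kappa>'
      using assms(2) by (intro excess_cong) auto
    have cong2: "excess t U (\<kappa>(w := z)) r = b" "excess t U (\<lambda>x. (\<kappa>(w := z)) x + t) r = a" for z
      unfolding a_def b_def using assms(2) by (intro excess_cong; auto)+
    have diff: "excess t (insert w U) \<kappa> (r(w := k)) -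
        excess t (insert w U) (\<kappa>(w := \<kappa> w + 1)) (r(w := k)) = (if int k > h then 1 else 0)" for k
      unfolding excess_insert[OF assms(1,2)] cong cong2
      by (simp add: a_def[symmetric] b_def[symmetric] h_def max_def)
    have h0: "0 \<le> h"
      using excess_le_excess_shift[OF assms(1,3), of t \<kappa> r] assms(4)[of w]
      by (auto simp: h_def a_def b_def algebra_simps)
    have "a + excess t U (\<lambda>_. c) r \<le> b"
      unfolding a_def b_def using assms(4) by (intro excess_exchange[OF assms(1,3) r]) auto
    moreover have "\<kappa> w \<le> c" using assms(4) by auto
    ultimately have hg: "h \<le> ?g r" by (simp add: h_def)
    have "(\<Sum>k\<le>nat (?g r). if int k > h then 1 else 0 :: int) = ?g r - h"
      using h0 hg by (subst card_threshold) auto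
    then show ?thesis unfolding diff by (simp add: h_def a_def b_def)
  qed
  have "(\<Sum>r\<in>demands t (insert w U) c. excess t (insert w U) \<kappa> r) -
         (\<Sum>r\<in>demands t (insert w U) c. excess t (insert w U) (\<kappa>(w := \<kappa> w + 1)) r) =
     (\<Sum>r\<in>demands t U (c + t).
        (c - \<kappa> w) - excess t U (\<lambda>_. c) r - excess t U (\<lambda>x. \<kappa> x + t) r + excess t U \<kappa> r)"
    unfolding sum_demands_insert[OF assms(1-3) c0] sum_subtractf[symmetric]
    by (intro sum.cong refl inner)
  then show ?thesis
    by (simp add: sum.distrib sum_subtractf)
qed

text \<open>
  The number of lattice points and an auxiliary sequence, for graphs on \<open>n\<close> vertices with
  \<open>c\<close> loops at each vertex. Removing a vertex turns \<open>(n, c)\<close> into \<open>(n - 1, c + t)\<close>, so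
  \<open>\<theta> = c + n t\<close> stays fixed along the recursion. The auxiliary sequence is the
  coefficient of the products of slacks at distinct vertices in the quadratic form that
  gives the total excess.
\<close>

fun lattice_count cross_coeff :: "real \<Rightarrow> real \<Rightarrow> nat \<Rightarrow> real" where
  "lattice_count t \<theta> 0 = 1"
| "lattice_count t \<theta> (Suc n) = (1 + \<theta> - t) * lattice_count t \<theta> n - real n * t * (1 + t) / 2 * lattice_count t \<theta> (n - 1)
     - real n * (real n - 1) * t\<^sup>2 / 2 * cross_coeff t \<theta> n"
| "cross_coeff t \<theta> 0 = 0"
| "cross_coeff t \<theta> (Suc 0) = 0"
| "cross_coeff t \<theta> (Suc (Suc n)) = t * (lattice_count t \<theta> n + real n * cross_coeff t \<theta> (Suc n))"

text \<open>
  Let \<open>p\<close> be the slack at one vertex and \<open>P\<close>, \<open>Q\<close> the sums of the other slacks and of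
  their squares. The quadratic form with coefficients \<open>C\<close> and \<open>G\<close> solves the difference
  equation of the total excess. On the smaller graph the three forms have slacks \<open>t\<close>, \<open>p\<close>
  and \<open>p + t\<close>, and their combination is the polar form of \<open>p\<close> and \<open>t\<close>, hence linear in
  \<open>P\<close>.
\<close>

lemma excess_form_step:
  fixes G P t A g C p Q :: real and n :: nat
  assumes "G * P = t * (A + (real n - 1) * g) * P"
  shows "C * ((P + p) + (Q + p\<^sup>2)) / 2 + G * ((P + p)\<^sup>2 - (Q + p\<^sup>2)) / 2 =
    C * ((P + p - 1) + (Q + (p - 1)\<^sup>2)) / 2 + G * ((P + p - 1)\<^sup>2 - (Q + (p - 1)\<^sup>2)) / 2 + p * C
    - (A * (real n * t + real n * t\<^sup>2) / 2 + g * ((real n * t)\<^sup>2 - real n * t\<^sup>2) / 2)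
    - (A * (P + Q) / 2 + g * (P\<^sup>2 - Q) / 2)
    + (A * ((P + real n * t) + (Q + 2 * t * P + real n * t\<^sup>2)) / 2
       + g * ((P + real n * t)\<^sup>2 - (Q + 2 * t * P + real n * t\<^sup>2)) / 2)" (is "?L = ?R")
proof -
  have "?L - ?R = G * P - t * (A + (real n - 1) * g) * P"
    by (simp add: field_simps power2_eq_square)
  then show ?thesis using assms by simp
qed

text \<open>
  The total excess over all lattice points for \<open>c\<close> loops at each vertex, evaluated with
  only \<open>\<kappa> x\<close> loops, is a quadratic form in the slacks \<open>c - \<kappa> x\<close>: it
  vanishes without slack, and its first differences are known from the smaller graph. The
  special case of constant slack \<open>t\<close> gives the number of lattice points on one more
  vertex. Both statements therefore are proved together, by induction on the number of
  vertices and, for the second one, on the total slack.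
\<close>

theorem card_demands_and_excess_sum:
  fixes V :: "'a set" and c :: int
  assumes "finite V" "0 \<le> t" "0 \<le> c" "card V = n"
  defines "\<theta> \<equiv> real_of_int (c + int n * t)"
  shows "real (card (demands t V c)) = lattice_count t \<theta> n"
    and "(\<And>x. x \<in> V \<Longrightarrow> 0 \<le> \<kappa> x \<and> \<kappa> x \<le> c) \<Longrightarrow>
     of_int (\<Sum>r\<in>demands t V c. excess t V \<kappa> r) =
       lattice_count t \<theta> (n - 1) * ((\<Sum>x\<in>V. of_int (c - \<kappa> x)) + (\<Sum>x\<in>V. (of_int (c - \<kappa> x))\<^sup>2)) / 2
       + cross_coeff t \<theta> n * ((\<Sum>x\<in>V. of_int (c - \<kappa> x))\<^sup>2 - (\<Sum>x\<in>V. (of_int (c - \<kappa> x))\<^sup>2)) / 2"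
proof -
  let ?E = "\<lambda>V c \<kappa>. \<Sum>r\<in>demands t V c. excess t V \<kappa> r"
  let ?P = "\<lambda>V c \<kappa>. \<Sum>x\<in>V. real_of_int (c - \<kappa> x)"
  let ?Q = "\<lambda>V c \<kappa>. \<Sum>x\<in>V. (real_of_int (c - \<kappa> x))\<^sup>2"
  let ?F = "\<lambda>\<theta> n V c \<kappa>. lattice_count t \<theta> (n - 1) * (?P V c \<kappa> + ?Q V c \<kappa>) / 2 + cross_coeff t \<theta> n * ((?P V c \<kappa>)\<^sup>2 - ?Q V c \<kappa>) / 2"
  have "\<forall>V::'a set. \<forall>c. finite V \<longrightarrow> 0 \<le> c \<longrightarrow> card V = n \<longrightarrow>
     real (card (demands t V c)) = lattice_count t (of_int (c + int n * t)) n \<and>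
     (\<forall>\<kappa>. (\<forall>x\<in>V. 0 \<le> \<kappa> x \<and> \<kappa> x \<le> c) \<longrightarrow> of_int (?E V c \<kappa>) = ?F (of_int (c + int n * t)) n V c \<kappa>)"
  proof (induction n)
    case 0
    then show ?case by (auto simp: demands_empty)
  next
    case (Suc n)
    show ?case
    proof (intro allI impI)
      fix V :: "'a set" and c :: int
      assume V: "finite V" "0 \<le> c" "card V = Suc n"
      define \<theta> where "\<theta> = real_of_int (c + int (Suc n) * t)"
      have \<theta>': "real_of_int (c + t + int n * t) = \<theta>" by (simp add: \<theta>_def algebra_simps)
      have IHc: "real (card (demands t U (c + t))) = lattice_count t \<theta> n" if "finite U" "card U = n" for U :: "'a set"
        using Suc.IH that V assms(2) \<theta>' by simp
      have IHe: "of_int (?E U (c + t) \<kappa>) = ?F \<theta> n U (c + t) \<kappa>"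
        if "finite U" "card U = n" "\<forall>x\<in>U. 0 \<le> \<kappa> x \<and> \<kappa> x \<le> c + t" for U :: "'a set" and \<kappa>
        using Suc.IH that V assms(2) \<theta>' by simp
      have card: "real (card (demands t V c)) = lattice_count t \<theta> (Suc n)"
      proof -
        obtain w U where U: "V = insert w U" "w \<notin> U" "card U = n" "finite U"
          using V card_Suc_eq_finite[of V n] by auto
        have "int (card (demands t V c)) = (\<Sum>r\<in>demands t V c. 1)" by simp
        also have "\<dots> = (\<Sum>r\<in>demands t U (c + t). c + t * int n + 1 - excess t U (\<lambda>_. c) r)"
        proof -
          have "0 \<le> c + t * int (card U) - excess t U (\<lambda>_. c) r" if "r \<in> demands t U (c + t)" for r
            using excess_le_excess_shift[OF U(4) assms(2), of t "\<lambda>_. c" r] that V(2)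
            by (simp add: demands_def)
          then show ?thesis
            unfolding U(1) sum_demands_insert[OF U(4,2) assms(2) V(2)] U(3)
            by (intro sum.cong) (auto simp: U(3))
        qed
        finally have "int (card (demands t V c)) =
          int (card (demands t U (c + t))) * (c + t * int n + 1) - ?E U (c + t) (\<lambda>_. c)"
          by (simp add: sum_subtractf)
        from arg_cong[OF this, of real_of_int]
        have "real (card (demands t V c)) = lattice_count t \<theta> n * (c + t * int n + 1) - ?F \<theta> n U (c + t) (\<lambda>_. c)"
          using IHc[OF U(4,3)] IHe[OF U(4,3), of "\<lambda>_. c"] V(2) assms(2) by simp
        also have "\<dots> = lattice_count t \<theta> (Suc n)"
          using U(3) by (simp add: \<theta>_def algebra_simps power2_eq_square add_divide_distrib diff_divide_distrib)
        finally show ?thesis .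
      qed
      have exc: "of_int (?E V c \<kappa>) = ?F \<theta> (Suc n) V c \<kappa>" if "\<forall>x\<in>V. 0 \<le> \<kappa> x \<and> \<kappa> x \<le> c" for \<kappa>
        using that
      proof (induction "nat (\<Sum>x\<in>V. c - \<kappa> x)" arbitrary: \<kappa> rule: less_induct)
        case less
        show ?case
        proof (cases "\<forall>x\<in>V. \<kappa> x = c")
          case True
          then have "excess t V \<kappa> r = 0" if "r \<in> demands t V c" for r
            using that excess_cong[of V \<kappa> "\<lambda>_. c" r r t] by (simp add: demands_def)
          then show ?thesis using True by simp
        next
          case False
          then obtain w where w: "w \<in> V" "\<kappa> w < c" using less.prems by force
          define U where "U = V - {w}"
          have U: "V = insert w U" "w \<notin> U" "card U = n" "finite U"
            using w V by (auto simp: U_def)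
          define \<kappa>' where "\<kappa>' = \<kappa>(w := \<kappa> w + 1)"
          have \<kappa>'U: "(\<Sum>x\<in>U. g (\<kappa>' x)) = (\<Sum>x\<in>U. g (\<kappa> x))" for g :: "int \<Rightarrow> 'b::comm_monoid_add"
            using U(2) by (intro sum.cong) (auto simp: \<kappa>'_def)
          have k': "of_int (?E V c \<kappa>') = ?F \<theta> (Suc n) V c \<kappa>'"
          proof (rule less.hyps)
            have "0 \<le> (\<Sum>x\<in>U. c - \<kappa> x)" using less.prems U by (intro sum_nonneg) auto
            then show "nat (\<Sum>x\<in>V. c - \<kappa>' x) < nat (\<Sum>x\<in>V. c - \<kappa> x)"
              using U w \<kappa>'U[of "\<lambda>k. c - k"] by (simp add: \<kappa>'_def)
            show "\<forall>x\<in>V. 0 \<le> \<kappa>' x \<and> \<kappa>' x \<le> c"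
              using less.prems w by (auto simp: \<kappa>'_def)
          qed
          have kstep: "real_of_int (?E V c \<kappa>) = of_int (?E V c \<kappa>') + of_int (c - \<kappa> w) * lattice_count t \<theta> n
             - ?F \<theta> n U (c + t) (\<lambda>_. c) - ?F \<theta> n U (c + t) (\<lambda>x. \<kappa> x + t) + ?F \<theta> n U (c + t) \<kappa>"
          proof -
            have "?E V c \<kappa> - ?E V c \<kappa>' = (c - \<kappa> w) * int (card (demands t U (c + t)))
               - ?E U (c + t) (\<lambda>_. c) - ?E U (c + t) (\<lambda>x. \<kappa> x + t) + ?E U (c + t) \<kappa>"
              unfolding U(1) \<kappa>'_def using less.prems U assms(2) by (intro excess_sum_increment) auto
            from arg_cong[OF this, of real_of_int]
            have "real_of_int (?E V c \<kappa>) = of_int (?E V c \<kappa>') + of_int (c - \<kappa> w) * real (card (demands t U (c + t)))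
               - real_of_int (?E U (c + t) (\<lambda>_. c)) - real_of_int (?E U (c + t) (\<lambda>x. \<kappa> x + t)) + real_of_int (?E U (c + t) \<kappa>)"
              by simp
            moreover have "of_int (?E U (c + t) (\<lambda>_. c)) = ?F \<theta> n U (c + t) (\<lambda>_. c)"
              using V assms(2) by (intro IHe U) auto
            moreover have "of_int (?E U (c + t) (\<lambda>x. \<kappa> x + t)) = ?F \<theta> n U (c + t) (\<lambda>x. \<kappa> x + t)"
            proof (intro IHe U ballI)
              fix x assume "x \<in> U"
              then have "0 \<le> \<kappa> x" "\<kappa> x \<le> c" using less.prems U(1) by auto
              then show "0 \<le> \<kappa> x + t \<and> \<kappa> x + t \<le> c + t" using assms(2) by linarith
            qed
            moreover have "of_int (?E U (c + t) \<kappa>) = ?F \<theta> n U (c + t) \<kappa>"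
            proof (intro IHe U ballI)
              fix x assume "x \<in> U"
              then have "0 \<le> \<kappa> x" "\<kappa> x \<le> c" using less.prems U(1) by auto
              then show "0 \<le> \<kappa> x \<and> \<kappa> x \<le> c + t" using assms(2) by linarith
            qed
            ultimately show ?thesis using IHc[OF U(4,3)] by simp
          qed
          define p where "p = real_of_int (c - \<kappa> w)"
          define P where "P = ?P U c \<kappa>"
          define Q where "Q = ?Q U c \<kappa>"
          have PQ: "?P V c \<kappa> = P + p" "?Q V c \<kappa> = Q + p\<^sup>2"
            "?P V c \<kappa>' = P + p - 1" "?Q V c \<kappa>' = Q + (p - 1)\<^sup>2"
            using U \<kappa>'U[of "\<lambda>k. real_of_int (c - k)"] \<kappa>'U[of "\<lambda>k. (real_of_int (c - k))\<^sup>2"]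
            by (simp_all add: P_def Q_def p_def \<kappa>'_def algebra_simps)
          have PQ1: "?P U (c + t) (\<lambda>_. c) = real n * real_of_int t"
             "?Q U (c + t) (\<lambda>_. c) = real n * (real_of_int t)\<^sup>2"
             "?P U (c + t) (\<lambda>x. \<kappa> x + t) = P" "?Q U (c + t) (\<lambda>x. \<kappa> x + t) = Q"
            using U(3) by (simp_all add: P_def Q_def)
          have PQ2: "?P U (c + t) \<kappa> = P + real n * real_of_int t"
            using U(3) by (simp add: P_def sum.distrib sum_subtractf algebra_simps)
          have PQ3: "?Q U (c + t) \<kappa> = Q + 2 * real_of_int t * P + real n * (real_of_int t)\<^sup>2"
          proof -
            have "?Q U (c + t) \<kappa> =
              (\<Sum>x\<in>U. (real_of_int (c - \<kappa> x))\<^sup>2 + 2 * real_of_int t * real_of_int (c - \<kappa> x) + (real_of_int t)\<^sup>2)"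
              by (intro sum.cong) (auto simp: power2_eq_square algebra_simps)
            also have "\<dots> = Q + 2 * real_of_int t * P + real n * (real_of_int t)\<^sup>2"
              unfolding P_def Q_def sum.distrib sum_distrib_left using U(3) by simp
            finally show ?thesis .
          qed
          have G: "cross_coeff t \<theta> (Suc n) * P = real_of_int t * (lattice_count t \<theta> (n - 1) + (real n - 1) * cross_coeff t \<theta> n) * P"
          proof (cases n)
            case 0
            then show ?thesis using U by (simp add: P_def)
          next
            case (Suc k)
            then show ?thesis by simp
          qed
          show ?thesis
            unfolding kstep k' PQ PQ1 PQ2 PQ3 diff_Suc_1 p_def[symmetric]
            using excess_form_step[OF G, of "lattice_count t \<theta> n" p Q] by simp
        qed
      qed
      show "real (card (demands t V c)) = lattice_count t (of_int (c + int (Suc n) * t)) (Suc n) \<and>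
       (\<forall>\<kappa>. (\<forall>x\<in>V. 0 \<le> \<kappa> x \<and> \<kappa> x \<le> c) \<longrightarrow>
         of_int (?E V c \<kappa>) = ?F (of_int (c + int (Suc n) * t)) (Suc n) V c \<kappa>)"
      proof (intro conjI allI impI)
        show "real (card (demands t V c)) = lattice_count t (of_int (c + int (Suc n) * t)) (Suc n)"
          using card unfolding \<theta>_def .
        show "of_int (?E V c \<kappa>) = ?F (of_int (c + int (Suc n) * t)) (Suc n) V c \<kappa>"
          if "\<forall>x\<in>V. 0 \<le> \<kappa> x \<and> \<kappa> x \<le> c" for \<kappa>
          using exc[OF that] unfolding \<theta>_def .
      qed
    qed
  qed
  note main = this[rule_format, OF assms(1,3,4)]
  show "real (card (demands t V c)) = lattice_count t \<theta> n"
    unfolding \<theta>_def by (rule conjunct1[OF main])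
  show "of_int (?E V c \<kappa>) = ?F \<theta> n V c \<kappa>" if "\<And>x. x \<in> V \<Longrightarrow> 0 \<le> \<kappa> x \<and> \<kappa> x \<le> c"
    unfolding \<theta>_def by (rule conjunct2[OF main, rule_format]) (use that in auto)
qed

section \<open>The parking function polytope as a polymatroid\<close>

text \<open>
  Among all sets of given size, the sum is largest on an initial segment.
\<close>

lemma sum_le_edges_meeting:
  assumes "finite I"
  shows "(\<Sum>i\<in>I. int m - 1 - int i) \<le> edges_meeting m (card I)"
  using assms
proof (induction "card I" arbitrary: I)
  case 0
  then show ?case by simp
next
  case (Suc k)
  define M where "M = Max I"
  have I: "I \<noteq> {}" "finite I" using Suc.hyps(2) Suc.prems by auto
  then have M: "M \<in> I" unfolding M_def by simp
  have "I \<subseteq> {..M}" using I by (auto simp: M_def)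
  then have "card I \<le> card {..M}" by (intro card_mono) auto
  then have "k \<le> M" using Suc.hyps(2) by simp
  moreover have "(\<Sum>i\<in>I - {M}. int m - 1 - int i) \<le> edges_meeting m k"
  proof -
    have "card (I - {M}) = k" using Suc.hyps(2) M I by simp
    then show ?thesis using Suc.hyps(1)[of "I - {M}"] I by simp
  qed
  moreover have "(\<Sum>i\<in>I. int m - 1 - int i) = (int m - 1 - int M) + (\<Sum>i\<in>I - {M}. int m - 1 - int i)"
    using I M by (subst sum.remove) auto
  ultimately show ?case
    unfolding Suc.hyps(2)[symmetric] by (simp add: edges_meeting_def)
qed

lemma monotone_enumeration:
  fixes f :: "'n::finite \<Rightarrow> 'b::linorder"
  obtains xs where "distinct xs" "set xs = UNIV" "length xs = CARD('n)" "sorted (map f xs)"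
    "bij_betw (\<lambda>i. xs ! i) {..<CARD('n)} UNIV"
proof -
  obtain ys where ys: "set ys = (UNIV :: 'n set)" "distinct ys"
    using finite_distinct_list[of "UNIV :: 'n set"] by auto
  define xs where "xs = sort_key f ys"
  have xs: "distinct xs" "set xs = UNIV" "sorted (map f xs)"
    using ys by (simp_all add: xs_def)
  then have l: "length xs = CARD('n)" using distinct_card[of xs] by simp
  have "bij_betw (\<lambda>i. xs ! i) {..<CARD('n)} UNIV"
    using bij_betw_nth[OF xs(1), of "{..<CARD('n)}" UNIV] l xs(2) by simp
  then show ?thesis using that xs l by blast
qed

lemma nondecreasing_rearrangement_map:
  fixes f :: "nat ^ 'n::finite"
  assumes "distinct xs" "set xs = UNIV" "sorted (map (\<lambda>j. f $ j) xs)"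
  shows "nondecreasing_rearrangement f = map (\<lambda>j. f $ j) xs"
proof -
  have "mset_set (UNIV :: 'n set) = mset xs"
    using mset_set_set[OF assms(1)] assms(2) by simp
  then have "nondecreasing_rearrangement f = sorted_list_of_multiset (mset (map (\<lambda>j. f $ j) xs))"
    by (simp add: nondecreasing_rearrangement_def)
  also have "\<dots> = sort (map (\<lambda>j. f $ j) xs)" by (rule sorted_list_of_multiset_mset)
  also have "\<dots> = map (\<lambda>j. f $ j) xs" using assms(3) by (rule sorted_sort_id)
  finally show ?thesis .
qed

text \<open>
  In this form the condition no longer refers to sorting; it bounds the values by a
  permutation of \<open>1, \<dots>, m\<close>, listed in decreasing order to match the order in which
  edges are counted.
\<close>

lemma parking_function_iff:
  fixes f :: "nat ^ 'n::finite"
  shows "parking_function f \<longleftrightarrow> (\<forall>j. 1 \<le> f $ j) \<and>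
    (\<exists>\<sigma>. bij_betw \<sigma> {..<CARD('n)} UNIV \<and> (\<forall>i<CARD('n). f $ \<sigma> i \<le> CARD('n) - i))"
proof -
  let ?m = "CARD('n)"
  obtain xs where xs: "distinct xs" "set xs = (UNIV :: 'n set)" "length xs = ?m"
    "sorted (map (\<lambda>j. f $ j) xs)" and bij: "bij_betw (\<lambda>i. xs ! i) {..<?m} UNIV"
    using monotone_enumeration[of "\<lambda>j. f $ j"] by blast
  have nd: "nondecreasing_rearrangement f ! i = f $ (xs ! i)" if "i < ?m" for i
    using that xs by (simp add: nondecreasing_rearrangement_map)
  show ?thesis
  proof (intro iffI conjI)
    assume pf: "parking_function f"
    then show "\<forall>j. 1 \<le> f $ j" by (simp add: parking_function_def)
    have rev: "bij_betw (\<lambda>i. ?m - 1 - i) {..<?m} {..<?m}"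
      by (rule bij_betw_byWitness[where f' = "\<lambda>i. ?m - 1 - i"]) auto
    show "\<exists>\<sigma>. bij_betw \<sigma> {..<?m} UNIV \<and> (\<forall>i<?m. f $ \<sigma> i \<le> ?m - i)"
    proof (intro exI conjI allI impI)
      show "bij_betw (\<lambda>i. xs ! (?m - 1 - i)) {..<?m} UNIV"
        using bij_betw_trans[OF rev bij] by (simp add: o_def)
      fix i assume i: "i < ?m"
      then have "nondecreasing_rearrangement f ! (?m - 1 - i) \<le> (?m - 1 - i) + 1"
        using pf unfolding parking_function_def by simp
      then show "f $ (xs ! (?m - 1 - i)) \<le> ?m - i" using nd[of "?m - 1 - i"] i by simp
    qed
  next
    assume R: "(\<forall>j. 1 \<le> f $ j) \<and> (\<exists>\<sigma>. bij_betw \<sigma> {..<?m} UNIV \<and> (\<forall>i<?m. f $ \<sigma> i \<le> ?m - i))"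
    then obtain \<sigma> where \<sigma>: "bij_betw \<sigma> {..<?m} (UNIV :: 'n set)" "\<And>i. i < ?m \<Longrightarrow> f $ \<sigma> i \<le> ?m - i"
      by blast
    have "nondecreasing_rearrangement f ! i \<le> i + 1" if i: "i < ?m" for i
    proof (rule ccontr)
      assume "\<not> ?thesis"
      then have big: "i + 1 < f $ (xs ! i)" using nd[OF i] by simp
      define J where "J = {j. f $ j \<le> i + 1}"
      have "J \<subseteq> (\<lambda>k. xs ! k) ` {..<i}"
      proof
        fix j assume j: "j \<in> J"
        have "j \<in> (\<lambda>i. xs ! i) ` {..<?m}" using bij by (simp add: bij_betw_def)
        then obtain k where k: "k < ?m" "j = xs ! k" by auto
        have "k < i"
        proof (rule ccontr)
          assume "\<not> k < i"
          then have "f $ (xs ! i) \<le> f $ (xs ! k)"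
            using sorted_nth_mono[OF xs(4), of i k] k xs(3) i by simp
          then show False using big j k by (simp add: J_def)
        qed
        then show "j \<in> (\<lambda>k. xs ! k) ` {..<i}" using k by blast
      qed
      then have "card J \<le> i"
        using surj_card_le[of "{..<i}" J "\<lambda>k. xs ! k"] by simp
      moreover have "\<sigma> ` {?m - 1 - i..<?m} \<subseteq> J"
      proof
        fix j assume "j \<in> \<sigma> ` {?m - 1 - i..<?m}"
        then obtain k where "j = \<sigma> k" "?m - 1 - i \<le> k" "k < ?m" by auto
        then show "j \<in> J" using \<sigma>(2)[of k] by (simp add: J_def)
      qed
      then have "card (\<sigma> ` {?m - 1 - i..<?m}) \<le> card J" by (intro card_mono) auto
      moreover have "inj_on \<sigma> {?m - 1 - i..<?m}"
        using \<sigma>(1) by (auto simp: bij_betw_def intro: inj_on_subset)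
      then have "card (\<sigma> ` {?m - 1 - i..<?m}) = i + 1"
        using i by (simp add: card_image)
      ultimately show False by simp
    qed
    then show "parking_function f" using R by (simp add: parking_function_def)
  qed
qed

text \<open>
  Summation by parts: the sum is a nonnegative combination of the prefix sums of \<open>d\<close>.
\<close>

lemma sum_by_parts_nonpos:
  fixes b d :: "nat \<Rightarrow> real"
  assumes "\<And>i. i < n \<Longrightarrow> 0 \<le> b i" "\<And>i. Suc i < n \<Longrightarrow> b (Suc i) \<le> b i"
    "\<And>k. k \<le> n \<Longrightarrow> (\<Sum>i<k. d i) \<le> 0"
  shows "(\<Sum>i<n. b i * d i) \<le> 0"
proof (cases n)
  case 0
  then show ?thesis by simp
next
  case (Suc k)
  have "l < n \<longrightarrow> (\<Sum>i<Suc l. b i * d i) \<le> b l * (\<Sum>i<Suc l. d i)" for l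
  proof (induction l)
    case 0
    then show ?case by simp
  next
    case (Suc l)
    show ?case
    proof
      assume l: "Suc l < n"
      then have "(\<Sum>i<Suc l. b i * d i) \<le> b l * (\<Sum>i<Suc l. d i)" using Suc.IH by simp
      also have "\<dots> \<le> b (Suc l) * (\<Sum>i<Suc l. d i)"
        using assms(2)[OF l] assms(3)[of "Suc l"] l by (intro mult_right_mono_neg) auto
      finally show "(\<Sum>i<Suc (Suc l). b i * d i) \<le> b (Suc l) * (\<Sum>i<Suc (Suc l). d i)"
        unfolding sum.lessThan_Suc[of _ "Suc l"] distrib_left by simp
    qed
  qed
  from this[of k] have "(\<Sum>i<n. b i * d i) \<le> b k * (\<Sum>i<n. d i)" unfolding Suc by blast
  also have "\<dots> \<le> 0" using assms(1)[of k] assms(3)[of n] Suc by (intro mult_nonneg_nonpos) auto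
  finally show ?thesis .
qed

lemma bounded_nat_vectors_finite: "finite {f :: nat ^ 'n::finite. \<forall>j. f $ j \<le> B}"
proof -
  have "{f :: nat ^ 'n. \<forall>j. f $ j \<le> B} \<subseteq> vec_lambda ` (UNIV \<rightarrow>\<^sub>E {..B})"
  proof
    fix f :: "nat ^ 'n" assume "f \<in> {f. \<forall>j. f $ j \<le> B}"
    then have "(\<lambda>j. f $ j) \<in> UNIV \<rightarrow>\<^sub>E {..B}" by (simp add: PiE_def)
    moreover have "f = vec_lambda (\<lambda>j. f $ j)" by (simp only: vec_lambda_eta)
    ultimately show "f \<in> vec_lambda ` (UNIV \<rightarrow>\<^sub>E {..B})"
      by (intro image_eqI[where x = "\<lambda>j. f $ j"])
  qed
  moreover have "finite (vec_lambda ` (UNIV \<rightarrow>\<^sub>E {..B}) :: (nat ^ 'n) set)"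
    by (intro finite_imageI finite_PiE finite_atMost finite)
  ultimately show ?thesis by (rule finite_subset)
qed

lemma parking_function_le: "parking_function (f :: nat ^ 'n::finite) \<Longrightarrow> f $ j \<le> CARD('n)"
proof -
  assume "parking_function f"
  then obtain \<sigma> where \<sigma>: "bij_betw \<sigma> {..<CARD('n)} (UNIV :: 'n set)" "\<And>i. i < CARD('n) \<Longrightarrow> f $ \<sigma> i \<le> CARD('n) - i"
    unfolding parking_function_iff by blast
  have "j \<in> \<sigma> ` {..<CARD('n)}" using \<sigma>(1) unfolding bij_betw_def by simp
  then obtain i where i: "i < CARD('n)" "j = \<sigma> i" by auto
  show ?thesis using \<sigma>(2)[OF i(1)] i(2) by simp
qed

lemma parking_function_subset_sum:
  assumes "parking_function (f :: nat ^ 'n::finite)"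
  shows "(\<Sum>j\<in>R. real (f $ j) - 1) \<le> of_int (edges_meeting CARD('n) (card R))"
proof -
  let ?m = "CARD('n)"
  obtain \<sigma> where \<sigma>: "bij_betw \<sigma> {..<?m} (UNIV :: 'n set)" "\<And>i. i < ?m \<Longrightarrow> f $ \<sigma> i \<le> ?m - i"
    using assms unfolding parking_function_iff by blast
  define I where "I = {i\<in>{..<?m}. \<sigma> i \<in> R}"
  have inj: "inj_on \<sigma> I" using \<sigma>(1) by (auto simp: I_def bij_betw_def intro: inj_on_subset)
  have "\<sigma> ` {..<?m} = UNIV" using \<sigma>(1) by (simp add: bij_betw_def)
  then have R: "\<sigma> ` I = R"
    unfolding I_def by (auto simp: image_iff)
  have "(\<Sum>j\<in>R. real (f $ j) - 1) = (\<Sum>i\<in>I. real (f $ \<sigma> i) - 1)"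
    unfolding R[symmetric] by (simp add: sum.reindex[OF inj])
  also have "\<dots> \<le> (\<Sum>i\<in>I. of_int (int ?m - 1 - int i))"
  proof (rule sum_mono)
    fix i assume "i \<in> I"
    then have "i < ?m" by (simp add: I_def)
    then have "f $ \<sigma> i + i \<le> ?m" using \<sigma>(2)[of i] by simp
    then show "real (f $ \<sigma> i) - 1 \<le> of_int (int ?m - 1 - int i)" by simp
  qed
  also have "\<dots> = of_int (\<Sum>i\<in>I. int ?m - 1 - int i)" by simp
  also have "\<dots> \<le> of_int (edges_meeting ?m (card I))"
    by (simp only: of_int_le_iff) (rule sum_le_edges_meeting, simp add: I_def)
  also have "card I = card R" using card_image[OF inj] R by simp
  finally show ?thesis .
qed

lemma convex_edge_bound_region:
  "convex {x :: real ^ 'n::finite. (\<forall>j. 1 \<le> x $ j) \<and>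
     (\<forall>R. (\<Sum>j\<in>R. x $ j - 1) \<le> of_int (edges_meeting CARD('n) (card R)))}"
proof (rule convexI)
  fix x y :: "real ^ 'n" and u v :: real
  assume x: "x \<in> {x. (\<forall>j. 1 \<le> x $ j) \<and> (\<forall>R. (\<Sum>j\<in>R. x $ j - 1) \<le> of_int (edges_meeting CARD('n) (card R)))}"
    and y: "y \<in> {x. (\<forall>j. 1 \<le> x $ j) \<and> (\<forall>R. (\<Sum>j\<in>R. x $ j - 1) \<le> of_int (edges_meeting CARD('n) (card R)))}"
    and uv: "0 \<le> u" "0 \<le> v" "u + v = 1"
  have nth: "(u *\<^sub>R x + v *\<^sub>R y) $ j = u * x $ j + v * y $ j" for j by simp
  have "1 \<le> u * x $ j + v * y $ j" for j
  proof -
    have "u * 1 + v * 1 \<le> u * x $ j + v * y $ j" using x y uv by (intro add_mono mult_left_mono) auto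
    then show ?thesis using uv by simp
  qed
  moreover have "(\<Sum>j\<in>R. u * x $ j + v * y $ j - 1) \<le> of_int (edges_meeting CARD('n) (card R))" for R
  proof -
    have eq: "u * x $ j + v * y $ j - 1 = u * (x $ j - 1) + v * (y $ j - 1)" for j
    proof -
      have "u * (x $ j - 1) + v * (y $ j - 1) = u * x $ j + v * y $ j - (u + v)"
        by (simp add: algebra_simps)
      then show ?thesis using uv by simp
    qed
    have "(\<Sum>j\<in>R. u * x $ j + v * y $ j - 1) = u * (\<Sum>j\<in>R. x $ j - 1) + v * (\<Sum>j\<in>R. y $ j - 1)"
      unfolding eq sum.distrib sum_distrib_left[symmetric] ..
    also have "\<dots> \<le> u * of_int (edges_meeting CARD('n) (card R)) + v * of_int (edges_meeting CARD('n) (card R))"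
      using x y uv by (intro add_mono mult_left_mono) auto
    also have "\<dots> = of_int (edges_meeting CARD('n) (card R))"
      unfolding distrib_right[symmetric] uv by simp
    finally show ?thesis .
  qed
  ultimately show "u *\<^sub>R x + v *\<^sub>R y \<in>
      {x. (\<forall>j. 1 \<le> x $ j) \<and> (\<forall>R. (\<Sum>j\<in>R. x $ j - 1) \<le> of_int (edges_meeting CARD('n) (card R)))}"
    unfolding mem_Collect_eq nth by blast
qed

text \<open>
  The greedy algorithm for polymatroids. The coordinates are visited from the smallest
  entry of \<open>a\<close> on; those with a negative entry receive the largest values still possible,
  the others receive \<open>1\<close>. As long as the entries of \<open>a\<close> are negative, the prefix sums of
  \<open>z\<close> along this order are bounded by those of the greedy vector, and summation by parts
  compares the two inner products; the other coordinates are compared directly.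
\<close>

lemma greedy_parking_function:
  fixes a z :: "real ^ 'n::finite"
  assumes z: "\<And>j. 1 \<le> z $ j" "\<And>R. (\<Sum>j\<in>R. z $ j - 1) \<le> of_int (edges_meeting CARD('n) (card R))"
  obtains f :: "nat ^ 'n" where "parking_function f" "a \<bullet> (\<chi> j. real (f $ j)) \<le> a \<bullet> z"
proof -
  let ?m = "CARD('n)"
  obtain xs where xs: "distinct xs" "set xs = (UNIV :: 'n set)" "length xs = ?m"
    "sorted (map (\<lambda>j. a $ j) xs)" and bij: "bij_betw (\<lambda>i. xs ! i) {..<?m} UNIV"
    using monotone_enumeration[of "\<lambda>j. a $ j"] by blast
  define \<sigma> where "\<sigma> = (\<lambda>i. xs ! i)"
  have bij: "bij_betw \<sigma> {..<?m} UNIV" using bij by (simp add: \<sigma>_def)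
  have mono: "a $ \<sigma> i \<le> a $ \<sigma> k" if "i \<le> k" "k < ?m" for i k
    using sorted_nth_mono[OF xs(4), of i k] that xs(3) by (simp add: \<sigma>_def)
  define v where "v = (\<lambda>i. if a $ \<sigma> i < 0 then ?m - i else 1)"
  define f :: "nat ^ 'n" where "f = (\<chi> j. v (the_inv_into {..<?m} \<sigma> j))"
  have f\<sigma>: "f $ \<sigma> i = v i" if "i < ?m" for i
    using the_inv_into_f_f[of \<sigma> "{..<?m}" i] bij that by (simp add: f_def bij_betw_def)
  have "parking_function f"
    unfolding parking_function_iff
  proof (intro conjI allI exI[of _ \<sigma>] impI bij)
    fix j
    have "j \<in> \<sigma> ` {..<?m}" using bij by (simp add: bij_betw_def)
    then obtain i where "i < ?m" "j = \<sigma> i" by auto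
    then show "1 \<le> f $ j" using f\<sigma>[of i] by (auto simp: v_def)
  next
    fix i assume "i < ?m"
    then show "f $ \<sigma> i \<le> ?m - i" using f\<sigma>[of i] by (auto simp: v_def)
  qed
  moreover have "a \<bullet> (\<chi> j. real (f $ j)) \<le> a \<bullet> z"
  proof -
    \<comment> \<open>where the entry of \<open>a\<close> is nonnegative, the bound \<open>1 \<le> z\<close> suffices, and the weight is set to \<open>0\<close>\<close>
    define b where "b = (\<lambda>i. max 0 (- a $ \<sigma> i))"
    define d where "d = (\<lambda>i. z $ \<sigma> i - 1 - (real ?m - 1 - real i))"
    have "(\<Sum>i<?m. b i * d i) \<le> 0"
    proof (rule sum_by_parts_nonpos)
      show "b (Suc i) \<le> b i" if "Suc i < ?m" for i
        using mono[of i "Suc i"] that by (simp add: b_def)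
      show "(\<Sum>i<k. d i) \<le> 0" if "k \<le> ?m" for k
      proof -
        have inj: "inj_on \<sigma> {..<k}"
          using bij that by (auto simp: bij_betw_def intro: inj_on_subset)
        have "(\<Sum>i<k. z $ \<sigma> i - 1) = (\<Sum>j\<in>\<sigma> ` {..<k}. z $ j - 1)"
          by (simp add: sum.reindex[OF inj])
        also have "\<dots> \<le> of_int (edges_meeting ?m (card (\<sigma> ` {..<k})))" by (rule z)
        also have "\<dots> = (\<Sum>i<k. real ?m - 1 - real i)"
          by (simp add: card_image[OF inj] edges_meeting_def)
        finally have "(\<Sum>i<k. z $ \<sigma> i - 1) - (\<Sum>i<k. real ?m - 1 - real i) \<le> 0" by simp
        then show ?thesis unfolding d_def sum_subtractf[symmetric] .
      qed
    qed (simp add: b_def)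
    moreover have "a $ \<sigma> i * real (f $ \<sigma> i) - b i * d i \<le> a $ \<sigma> i * z $ \<sigma> i" if i: "i < ?m" for i
    proof (cases "a $ \<sigma> i < 0")
      case True
      then have eqs: "real (f $ \<sigma> i) = real ?m - real i" "b i = - a $ \<sigma> i"
        using f\<sigma>[OF i] i by (simp_all add: v_def b_def of_nat_diff)
      show ?thesis unfolding eqs d_def by (simp add: algebra_simps)
    next
      case False
      then have "real (f $ \<sigma> i) = 1" "b i = 0" using f\<sigma>[OF i] by (simp_all add: v_def b_def)
      then show ?thesis using mult_left_mono[OF z(1)[of "\<sigma> i"], of "a $ \<sigma> i"] False by simp
    qed
    then have "(\<Sum>i<?m. a $ \<sigma> i * real (f $ \<sigma> i) - b i * d i) \<le> (\<Sum>i<?m. a $ \<sigma> i * z $ \<sigma> i)"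
      by (intro sum_mono) auto
    ultimately have "(\<Sum>i<?m. a $ \<sigma> i * real (f $ \<sigma> i)) \<le> (\<Sum>i<?m. a $ \<sigma> i * z $ \<sigma> i)"
      by (simp add: sum_subtractf)
    then show ?thesis
      using sum.reindex_bij_betw[OF bij, of "\<lambda>j. a $ j * real (f $ j)"]
        sum.reindex_bij_betw[OF bij, of "\<lambda>j. a $ j * z $ j"]
      by (simp add: inner_vec_def)
  qed
  ultimately show ?thesis using that by blast
qed

text \<open>
  Shifted by the all-ones vector, the polytope is the polymatroid of the complete graph.
  The inequalities hold at the vertices and are preserved by convex combinations.
  Conversely, a point outside the hull would be separated from it by a hyperplane, and
  the greedy parking function for its normal vector lies on the wrong side.
\<close>

theorem mem_parking_function_polytope_iff:
  fixes x :: "real ^ 'n::finite"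
  shows "x \<in> parking_function_polytope \<longleftrightarrow>
    (\<forall>j. 1 \<le> x $ j) \<and> (\<forall>R. (\<Sum>j\<in>R. x $ j - 1) \<le> of_int (edges_meeting CARD('n) (card R)))"
    (is "_ \<longleftrightarrow> ?H x")
proof
  let ?V = "{(\<chi> j. real (f $ j)) :: real ^ 'n | f. parking_function f}"
  have "?V \<subseteq> {x. ?H x}"
  proof clarsimp
    fix f :: "nat ^ 'n" assume f: "parking_function f"
    then have "\<forall>j. 1 \<le> f $ j" unfolding parking_function_iff by blast
    then show "(\<forall>j. Suc 0 \<le> f $ j) \<and>
      (\<forall>R. (\<Sum>j\<in>R. real (f $ j) - 1) \<le> of_int (edges_meeting CARD('n) (card R)))"
      using parking_function_subset_sum[OF f] by simp
  qed
  then have "parking_function_polytope \<subseteq> {x :: real ^ 'n. ?H x}"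
    unfolding parking_function_polytope_def by (rule hull_minimal) (rule convex_edge_bound_region)
  then show "x \<in> parking_function_polytope \<Longrightarrow> ?H x" by blast
  assume H: "?H x"
  show "x \<in> parking_function_polytope"
  proof (rule ccontr)
    assume x: "x \<notin> parking_function_polytope"
    have "finite {f :: nat ^ 'n. parking_function f}"
      by (rule finite_subset[OF _ bounded_nat_vectors_finite[of "CARD('n)"]]) (auto intro: parking_function_le)
    then have "finite ?V" by (simp add: setcompr_eq_image)
    then have "closed (parking_function_polytope :: (real ^ 'n) set)"
      unfolding parking_function_polytope_def
      by (intro compact_imp_closed compact_convex_hull finite_imp_compact)
    moreover have "convex (parking_function_polytope :: (real ^ 'n) set)"
      unfolding parking_function_polytope_def by simp
    ultimately obtain a b where ab: "a \<bullet> x < b" "\<forall>y\<in>parking_function_polytope. b < a \<bullet> y"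
      using separating_hyperplane_closed_point[of parking_function_polytope x] x by blast
    obtain f :: "nat ^ 'n" where f: "parking_function f" "a \<bullet> (\<chi> j. real (f $ j)) \<le> a \<bullet> x"
      using greedy_parking_function[of x a] H by blast
    have "(\<chi> j. real (f $ j)) \<in> (parking_function_polytope :: (real ^ 'n) set)"
      unfolding parking_function_polytope_def using f(1) by (intro hull_inc) blast
    then show False using ab f(2) by force
  qed
qed

text \<open>
  The open cube between the all-ones and the all-twos vector is contained in the
  polytope, since a set of \<open>k\<close> vertices meets at least \<open>k\<close> edges as soon as there are
  three vertices.
\<close>

lemma aff_dim_parking_function_polytope:
  assumes "CARD('n::finite) \<ge> 3"
  shows "aff_dim (parking_function_polytope :: (real ^ 'n) set) = int CARD('n)"
proof -
  let ?B = "box (\<chi> j. 1) (\<chi> j. 2) :: (real ^ 'n) set"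
  have "?B \<subseteq> parking_function_polytope"
  proof
    fix x :: "real ^ 'n" assume "x \<in> ?B"
    then have x: "1 < x $ j" "x $ j < 2" for j by (auto simp: mem_box_cart)
    have "(\<Sum>j\<in>R. x $ j - 1) \<le> of_int (edges_meeting CARD('n) (card R))" for R
    proof -
      have k: "card R \<le> CARD('n)" by (intro card_mono) auto
      have "(\<Sum>j\<in>R. x $ j - 1) \<le> (\<Sum>j\<in>R. 1)" using x(2) by (intro sum_mono) (auto simp: less_imp_le)
      also have "\<dots> = real (card R)" by simp
      also have "\<dots> \<le> of_int (edges_meeting CARD('n) (card R))"
      proof -
        have "int (card R) * 2 \<le> int (card R) * (2 * int CARD('n) - int (card R) - 1)"
          using k assms by (intro mult_left_mono) auto
        then have "int (card R) \<le> edges_meeting CARD('n) (card R)"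
          using two_edges_meeting[of "CARD('n)" "card R"] by linarith
        then show ?thesis by linarith
      qed
      finally show ?thesis .
    qed
    then show "x \<in> parking_function_polytope"
      unfolding mem_parking_function_polytope_iff using x(1) by (simp add: less_imp_le)
  qed
  moreover have "?B \<noteq> {}" by (simp add: interval_ne_empty_cart)
  ultimately have "interior (parking_function_polytope :: (real ^ 'n) set) \<noteq> {}"
    using interior_maximal[OF _ open_box] by blast
  then show ?thesis by (simp add: aff_dim_nonempty_interior)
qed

lemma dilated_lattice_points:
  assumes "1 \<le> t"
  shows "(\<lambda>x. real t *\<^sub>R x) ` (parking_function_polytope :: (real ^ 'n::finite) set) \<inter> integer_lattice
    = (\<lambda>r. \<chi> j. real (t + r j)) ` demands (int t) UNIV 0"
proof -
  have mem_demands: "r \<in> demands (int t) UNIV 0 \<longleftrightarrow>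
     (\<forall>R. (\<Sum>j\<in>R. real (r j)) \<le> real t * of_int (edges_meeting CARD('n) (card R)))" for r :: "'n \<Rightarrow> nat"
  proof -
    have "r \<in> demands (int t) UNIV 0 \<longleftrightarrow> excess (int t) UNIV (\<lambda>_. 0) r \<le> 0"
      using excess_nonneg[of "UNIV :: 'n set" "int t" "\<lambda>_. 0" r] by (auto simp: demands_def)
    also have "\<dots> \<longleftrightarrow> (\<forall>R. (\<Sum>j\<in>R. int (r j)) \<le> int t * edges_meeting CARD('n) (card R))"
      by (subst excess_le_iff) (auto simp: excess_on_def)
    also have "\<dots> \<longleftrightarrow> (\<forall>R. (\<Sum>j\<in>R. real (r j)) \<le> real t * of_int (edges_meeting CARD('n) (card R)))"
    proof -
      have "(\<Sum>j\<in>R. int (r j)) \<le> int t * edges_meeting CARD('n) (card R) \<longleftrightarrow>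
        (\<Sum>j\<in>R. real (r j)) \<le> real t * of_int (edges_meeting CARD('n) (card R))" for R
        using of_int_le_iff[of "\<Sum>j\<in>R. int (r j)" "int t * edges_meeting CARD('n) (card R)", where 'a = real, symmetric]
        by simp
      then show ?thesis by simp
    qed
    finally show ?thesis .
  qed
  have t: "0 < real t" using assms by simp
  show ?thesis
  proof (intro equalityI subsetI)
    fix y :: "real ^ 'n"
    assume "y \<in> (\<lambda>x. real t *\<^sub>R x) ` parking_function_polytope \<inter> integer_lattice"
    then obtain x where x: "x \<in> parking_function_polytope" "y = real t *\<^sub>R x" and y: "y \<in> integer_lattice"
      by blast
    note H = x(1)[unfolded mem_parking_function_polytope_iff]
    have "\<exists>k. y $ j = real (t + k)" for j
    proof -
      obtain z where z: "y $ j = of_int z" using y by (auto simp: integer_lattice_def elim: Ints_cases)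
      have "real t * 1 \<le> real t * x $ j" using H by (intro mult_left_mono) auto
      then have "real t \<le> of_int z" using z x(2) by simp
      then have "int t \<le> z" by linarith
      then have "y $ j = real (t + nat (z - int t))" using z by simp
      then show ?thesis by blast
    qed
    then have "\<forall>j. \<exists>k. y $ j = real (t + k)" by blast
    from choice[OF this] obtain r where r: "\<And>j. y $ j = real (t + r j)" by blast
    have "r \<in> demands (int t) UNIV 0"
      unfolding mem_demands
    proof
      fix R
      have "real (r j) = real t * (x $ j - 1)" for j
        using r[of j] x(2) by (simp add: algebra_simps)
      then have "(\<Sum>j\<in>R. real (r j)) = real t * (\<Sum>j\<in>R. x $ j - 1)" by (simp add: sum_distrib_left)
      also have "\<dots> \<le> real t * of_int (edges_meeting CARD('n) (card R))"
        using H by (intro mult_left_mono) auto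
      finally show "(\<Sum>j\<in>R. real (r j)) \<le> real t * of_int (edges_meeting CARD('n) (card R))" .
    qed
    moreover have "y = (\<chi> j. real (t + r j))" using r by (simp add: vec_eq_iff)
    ultimately show "y \<in> (\<lambda>r. \<chi> j. real (t + r j)) ` demands (int t) UNIV 0" by blast
  next
    fix y :: "real ^ 'n"
    assume "y \<in> (\<lambda>r. \<chi> j. real (t + r j)) ` demands (int t) UNIV 0"
    then obtain r where r: "r \<in> demands (int t) UNIV 0" "y = (\<chi> j. real (t + r j))" by blast
    define x :: "real ^ 'n" where "x = (\<chi> j. 1 + real (r j) / real t)"
    have "x \<in> parking_function_polytope"
      unfolding mem_parking_function_polytope_iff
    proof (intro conjI allI)
      fix R
      have "(\<Sum>j\<in>R. x $ j - 1) = (\<Sum>j\<in>R. real (r j)) / real t"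
        by (simp add: x_def sum_divide_distrib)
      also have "\<dots> \<le> of_int (edges_meeting CARD('n) (card R))"
        using r(1) t unfolding mem_demands by (simp add: divide_le_eq mult.commute)
      finally show "(\<Sum>j\<in>R. x $ j - 1) \<le> of_int (edges_meeting CARD('n) (card R))" .
    qed (simp add: x_def)
    moreover have "y = real t *\<^sub>R x" using t r(2) by (simp add: x_def vec_eq_iff distrib_left)
    moreover have "y \<in> integer_lattice" using r(2) by (simp add: integer_lattice_def)
    ultimately show "y \<in> (\<lambda>x. real t *\<^sub>R x) ` parking_function_polytope \<inter> integer_lattice" by blast
  qed
qed

lemma card_dilated_lattice_points:
  assumes "1 \<le> t"
  shows "card ((\<lambda>x. real t *\<^sub>R x) ` (parking_function_polytope :: (real ^ 'n::finite) set) \<inter> integer_lattice)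
    = card (demands (int t) (UNIV :: 'n set) 0)"
  unfolding dilated_lattice_points[OF assms]
  by (intro card_image inj_onI) (simp add: vec_eq_iff fun_eq_iff)

section \<open>The generating function of the counts\<close>

text \<open>
  The binomial series of \<open>1 / sqrt (1 - X)\<close>.
\<close>

definition inv_sqrt_fps :: "real fps" where
  "inv_sqrt_fps = Abs_fps (\<lambda>l. \<Prod>i<l. (2 * real i + 1) / (2 * real i + 2))"

lemma inv_sqrt_fps_nth_0: "inv_sqrt_fps $$ 0 = 1"
  by (simp add: inv_sqrt_fps_def)

lemma inv_sqrt_fps_nth_Suc:
  "inv_sqrt_fps $$ Suc l = inv_sqrt_fps $$ l * (2 * real l + 1) / (2 * real l + 2)"
  by (simp add: inv_sqrt_fps_def)

lemma inv_sqrt_fps_pos: "0 < inv_sqrt_fps $$ l"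
  by (simp add: inv_sqrt_fps_def prod_pos)

lemma inv_sqrt_fps_ODE: "(1 - fps_X) * fps_deriv inv_sqrt_fps = fps_const (1/2) * inv_sqrt_fps"
proof (rule fps_ext)
  fix n
  have rec: "(real l + 1) * inv_sqrt_fps $$ Suc l = (real l + 1/2) * inv_sqrt_fps $$ l" for l
    unfolding inv_sqrt_fps_nth_Suc by (simp add: field_simps)
  have "((1 - fps_X) * fps_deriv inv_sqrt_fps) $$ n =
     (real n + 1) * inv_sqrt_fps $$ Suc n - real n * inv_sqrt_fps $$ n"
    by (cases n) (simp_all add: left_diff_distrib)
  also have "\<dots> = (fps_const (1/2) * inv_sqrt_fps) $$ n"
    unfolding rec by (simp add: left_diff_distrib[symmetric])
  finally show "((1 - fps_X) * fps_deriv inv_sqrt_fps) $$ n = (fps_const (1/2) * inv_sqrt_fps) $$ n" .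
qed

text \<open>
  The series of \<open>exp (X\<^sup>2 / 4)\<close>.
\<close>

definition gauss_fps :: "real fps" where
  "gauss_fps = fps_exp (1/4) oo fps_X ^ 2"

lemma gauss_fps_deriv: "fps_deriv gauss_fps = fps_const (1/2) * fps_X * gauss_fps"
proof -
  have "fps_deriv gauss_fps = (fps_const (1/4) * fps_exp (1/4) oo fps_X ^ 2) * (2 * fps_X)"
    unfolding gauss_fps_def by (subst fps_compose_deriv) (auto simp: power2_eq_square)
  also have "\<dots> = fps_const (1/4) * gauss_fps * (2 * fps_X)"
    unfolding gauss_fps_def by (subst fps_compose_mult_distrib) auto
  also have "\<dots> = (fps_const (1/4) * 2) * fps_X * gauss_fps" by (simp add: algebra_simps)
  also have "fps_const (1/4 :: real) * 2 = fps_const (1/2)"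
    by (simp add: numeral_fps_const)
  finally show ?thesis .
qed

lemma gauss_fps_nonneg: "0 \<le> gauss_fps $$ n"
  unfolding gauss_fps_def fps_compose_nth
  by (intro sum_nonneg mult_nonneg_nonneg) (simp_all add: power_mult[symmetric] fps_X_power_nth)

text \<open>
  The series of \<open>sqrt (1 - X) exp ((m - 3/2) X + X\<^sup>2 / 4)\<close>. The square root is
  written as \<open>(1 - X) / sqrt (1 - X)\<close> because the series of \<open>1 / sqrt (1 - X)\<close> has
  positive coefficients, so that all signs come from the factor \<open>1 - X\<close>.
\<close>

definition kernel_fps :: "real \<Rightarrow> real fps" where
  "kernel_fps m = (1 - fps_X) * inv_sqrt_fps * fps_exp (m - 3/2) * gauss_fps"

lemma fps_half: "fps_const (1/2 :: real) + fps_const (1/2) = 1"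
  by (simp flip: fps_const_1_eq_1)

lemma kernel_fps_ODE:
  "(1 - fps_X) * fps_deriv (kernel_fps m) =
     kernel_fps m * (fps_const (m - 2) * (1 - fps_X) - fps_const (1/2) * fps_X ^ 2)"
proof -
  define h :: "real fps" where "h = fps_const (1/2)"
  define a where "a = fps_const (m - 3/2)"
  define E where "E = fps_exp (m - 3/2)"
  define G where "G = inv_sqrt_fps * E * gauss_fps"
  have a: "a = fps_const (m - 2) + h" by (simp add: a_def h_def)
  have h: "h + h = 1" unfolding h_def by (rule fps_half)
  have "fps_deriv (kernel_fps m) = - G +
      ((1 - fps_X) * fps_deriv inv_sqrt_fps) * E * gauss_fps + (1 - fps_X) * G * (a + h * fps_X)"
    unfolding kernel_fps_def G_def E_def a_def h_def
    by (simp add: gauss_fps_deriv algebra_simps)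
  also have "(1 - fps_X) * fps_deriv inv_sqrt_fps = h * inv_sqrt_fps"
    unfolding h_def by (rule inv_sqrt_fps_ODE)
  also have "- G + h * inv_sqrt_fps * E * gauss_fps = (h - (h + h)) * G"
    unfolding h by (simp add: G_def algebra_simps)
  finally have "fps_deriv (kernel_fps m) = G * (- h + (1 - fps_X) * (a + h * fps_X))"
    by (simp add: algebra_simps)
  moreover have "kernel_fps m = (1 - fps_X) * G"
    by (simp add: kernel_fps_def G_def E_def mult.assoc)
  moreover have "- h + (1 - fps_X) * (a + h * fps_X) = fps_const (m - 2) * (1 - fps_X) - h * fps_X ^ 2"
    unfolding a by (simp add: algebra_simps power2_eq_square)
  ultimately show ?thesis unfolding h_def[symmetric] by (simp add: mult.assoc)
qed

text \<open>
  The series of \<open>sqrt (1 - t X) exp ((1 + (m - 1/2) t) X - t X\<^sup>2 / 4)\<close>, which is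
  the exponential generating function of the lattice point counts: its \<open>n\<close>-th coefficient
  belongs to the graph on \<open>n\<close> vertices that remains after \<open>m - n\<close> vertices have been
  removed, with \<open>(m - n) t\<close> loops at each vertex. It is written in a form that separates
  the powers of \<open>1 + t\<close> from those of \<open>t\<close>.
\<close>

definition count_fps :: "real \<Rightarrow> real \<Rightarrow> real fps" where
  "count_fps m t = (fps_exp (1 + t) oo (fps_X - fps_const (t/4) * fps_X ^ 2)) *
     (kernel_fps m oo (fps_const t * fps_X))"

lemma kernel_scaled_ODE:
  fixes m t :: real
  defines "T \<equiv> fps_const t"
  defines "k \<equiv> kernel_fps m oo (T * fps_X)"
  shows "(1 - T * fps_X) * fps_deriv k =
     T * k * (fps_const (m - 2) * (1 - T * fps_X) - fps_const (1/2) * (T * fps_X) ^ 2)"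
proof -
  define g where "g = T * fps_X"
  have g0: "g $$ 0 = 0" by (simp add: g_def T_def)
  define k' where "k' = fps_deriv (kernel_fps m) oo g"
  have "((1 - fps_X) * fps_deriv (kernel_fps m)) oo g =
     (kernel_fps m * (fps_const (m - 2) * (1 - fps_X) - fps_const (1/2) * fps_X ^ 2)) oo g"
    by (simp only: kernel_fps_ODE)
  then have "(1 - g) * k' = k * (fps_const (m - 2) * (1 - g) - fps_const (1/2) * g ^ 2)"
    using g0 unfolding k'_def k_def g_def[symmetric]
    by (simp add: fps_compose_mult_distrib fps_compose_sub_distrib fps_compose_power[OF g0, symmetric])
  moreover have "fps_deriv k = k' * T"
    using g0 unfolding k_def g_def[symmetric] k'_def
    by (subst fps_compose_deriv) (auto simp: g_def T_def)
  ultimately show ?thesis unfolding g_def[symmetric] by algebra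
qed

lemma exp_compose_deriv:
  fixes s t :: real
  defines "b \<equiv> fps_X - fps_const (t/4) * fps_X ^ 2"
  shows "fps_deriv (fps_exp s oo b) = fps_const s * (fps_exp s oo b) * (1 - fps_const (1/2) * fps_const t * fps_X)"
proof -
  have b0: "b $$ 0 = 0" by (simp add: b_def)
  have "fps_const (t/4) * 2 = fps_const (1/2) * fps_const t"
    by (simp add: numeral_fps_const)
  moreover have "fps_deriv b = 1 - (fps_const (t/4) * 2) * fps_X"
    by (simp add: b_def power2_eq_square algebra_simps)
  ultimately have db: "fps_deriv b = 1 - fps_const (1/2) * fps_const t * fps_X" by simp
  have "fps_deriv (fps_exp s oo b) = (fps_const s * fps_exp s oo b) * fps_deriv b"
    by (subst fps_compose_deriv[OF b0]) simp
  also have "fps_const s * fps_exp s oo b = fps_const s * (fps_exp s oo b)"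
    by (subst fps_compose_mult_distrib[OF b0]) simp
  finally show ?thesis unfolding db .
qed

text \<open>
  What is left of the differential equation of the series when the first two terms of the
  recursion for the counts have been moved to the left. It corresponds to the auxiliary
  sequence of that recursion.
\<close>

definition remainder_fps :: "real \<Rightarrow> real \<Rightarrow> real fps" where
  "remainder_fps m t = fps_deriv (count_fps m t) - fps_const (1 + (m - 1) * t) * count_fps m t
     + fps_const (t * (1 + t) / 2) * fps_X * count_fps m t"

lemma remainder_fps_eq:
  "(1 - fps_const t * fps_X) * remainder_fps m t = - fps_const (t^3 / 2) * fps_X ^ 2 * count_fps m t"
proof -
  define T where "T = fps_const t"
  define h :: "real fps" where "h = fps_const (1/2)"
  define S where "S = fps_const (1 + t)"
  define b where "b = fps_const (m - 2)"
  define B where "B = fps_exp (1 + t) oo (fps_X - fps_const (t/4) * fps_X ^ 2)"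
  define k where "k = kernel_fps m oo (T * fps_X)"
  have C: "count_fps m t = B * k" by (simp add: count_fps_def B_def k_def T_def)
  have k': "(1 - T * fps_X) * fps_deriv k = T * k * (b * (1 - T * fps_X) - h * (T * fps_X) ^ 2)"
    unfolding T_def k_def b_def h_def by (rule kernel_scaled_ODE)
  have B': "fps_deriv B = S * B * (1 - h * T * fps_X)"
    unfolding B_def S_def h_def T_def by (rule exp_compose_deriv)
  have c: "fps_const (1 + (m - 1) * t) = S + T * b" "fps_const (t * (1 + t) / 2) = h * S * T"
    "fps_const (t^3/2) = h * T ^ 3"
    by (simp_all add: S_def T_def b_def h_def algebra_simps fps_const_power)
  have "(1 - T * fps_X) * (fps_deriv B * k + B * fps_deriv k - (S + T * b) * (B * k) + h * S * T * fps_X * (B * k)) =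
    - (h * T ^ 3) * fps_X ^ 2 * (B * k)"
    using k' B' by algebra
  then show ?thesis
    unfolding remainder_fps_def C c T_def[symmetric] by (simp add: algebra_simps)
qed

lemma remainder_fps_0: "remainder_fps m t $$ 0 = 0"
  using arg_cong[OF remainder_fps_eq[of t m], of "\<lambda>f. f $$ 0"] by simp

lemma remainder_fps_Suc:
  "remainder_fps m t $$ Suc n = t * remainder_fps m t $$ n
     - (if n = 0 then 0 else t^3 / 2 * count_fps m t $$ (n - 1))"
proof -
  have "((1 - fps_const t * fps_X) * remainder_fps m t) $$ Suc n =
      remainder_fps m t $$ Suc n - t * remainder_fps m t $$ n"
    by (simp add: left_diff_distrib mult.assoc)
  moreover have "(- fps_const (t^3 / 2) * fps_X ^ 2 * count_fps m t) $$ Suc n =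
      - (if n = 0 then 0 else t^3 / 2 * count_fps m t $$ (n - 1))"
    by (simp add: mult.assoc fps_X_power_mult_nth)
  ultimately show ?thesis using remainder_fps_eq[of t m] by simp
qed

lemma count_fps_Suc:
  "real (Suc n) * count_fps m t $$ Suc n = remainder_fps m t $$ n + (1 + (m - 1) * t) * count_fps m t $$ n
     - (if n = 0 then 0 else t * (1 + t) / 2 * count_fps m t $$ (n - 1))"
  by (cases n) (simp_all add: remainder_fps_def mult.assoc)

lemma count_fps_0: "count_fps m t $$ 0 = 1"
  by (simp add: count_fps_def kernel_fps_def inv_sqrt_fps_nth_0 gauss_fps_def)

text \<open>
  The recursions of \<open>lattice_count\<close> and \<open>cross_coeff\<close> at \<open>\<theta> = m t\<close>, the value for
  the graph without loops on \<open>m\<close> vertices, are those of the coefficients of the two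
  series. The auxiliary sequence is compared only after multiplication by
  \<open>n (n - 1) t\<^sup>2\<close>; this avoids dividing by a number that may vanish.
\<close>

theorem lattice_count_eq_count_fps:
  "lattice_count t (m * t) n = fact n * count_fps m t $$ n \<and>
   real n * (real n - 1) * t\<^sup>2 / 2 * cross_coeff t (m * t) n = - fact n * remainder_fps m t $$ n"
proof (induction n rule: less_induct)
  case (less n)
  consider "n = 0" | "n = 1" | k where "n = Suc (Suc k)" by (cases n; cases "n - 1"; force)
  then show ?case
  proof cases
    case 1
    then show ?thesis by (simp add: count_fps_0 remainder_fps_0)
  next
    case 2
    then show ?thesis
      using count_fps_Suc[of 0 m t] remainder_fps_Suc[of m t 0]
      by (simp add: count_fps_0 remainder_fps_0 algebra_simps)
  next
    case 3
    let ?C = "count_fps m t" and ?H = "remainder_fps m t" and ?\<theta> = "m * t"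
    have k0: "lattice_count t ?\<theta> k = fact k * ?C $$ k"
      using less.IH[of k] 3 by simp
    have k1: "lattice_count t ?\<theta> (Suc k) = fact (Suc k) * ?C $$ Suc k"
      "real (Suc k) * real k * t\<^sup>2 / 2 * cross_coeff t ?\<theta> (Suc k) = - fact (Suc k) * ?H $$ Suc k"
      using less.IH[of "Suc k"] 3 by simp_all
    have "lattice_count t ?\<theta> n = (1 + m * t - t) * (fact (Suc k) * ?C $$ Suc k)
        - real (Suc k) * t * (1 + t) / 2 * (fact k * ?C $$ k) + fact (Suc k) * ?H $$ Suc k"
    proof -
      have "lattice_count t ?\<theta> n = (1 + m * t - t) * lattice_count t ?\<theta> (Suc k)
        - real (Suc k) * t * (1 + t) / 2 * lattice_count t ?\<theta> k
        - real (Suc k) * real k * t\<^sup>2 / 2 * cross_coeff t ?\<theta> (Suc k)"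
        unfolding 3 by (subst lattice_count.simps(2)) simp
      then show ?thesis unfolding k0 k1 by simp
    qed
    also have "\<dots> = fact (Suc k) * (?H $$ Suc k + (1 + (m - 1) * t) * ?C $$ Suc k - t * (1 + t) / 2 * ?C $$ k)"
      by (simp add: algebra_simps add_divide_distrib diff_divide_distrib)
    also have "\<dots> = fact (Suc k) * (real n * ?C $$ n)"
      using count_fps_Suc[of "Suc k" m t] unfolding 3 by simp
    also have "\<dots> = fact n * ?C $$ n" unfolding 3 by (simp add: algebra_simps)
    finally have c: "lattice_count t ?\<theta> n = fact n * ?C $$ n" .
    have "real n * (real n - 1) * t\<^sup>2 / 2 * cross_coeff t ?\<theta> n =
      real (k + 2) * t * (real (Suc k) * t\<^sup>2 / 2 * lattice_count t ?\<theta> k + real (Suc k) * real k * t\<^sup>2 / 2 * cross_coeff t ?\<theta> (Suc k))"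
      unfolding 3 cross_coeff.simps by (simp add: algebra_simps add_divide_distrib)
    also have "\<dots> = - real (k + 2) * fact (Suc k) * (t * ?H $$ Suc k - t^3 / 2 * ?C $$ k)"
      unfolding k0 k1 by (simp add: algebra_simps power3_eq_cube power2_eq_square add_divide_distrib)
    also have "\<dots> = - fact n * ?H $$ n"
    proof -
      have "- real (k + 2) * fact (Suc k) = (- fact n :: real)" unfolding 3 by (simp add: algebra_simps)
      moreover have "t * ?H $$ Suc k - t^3 / 2 * ?C $$ k = ?H $$ n"
        using remainder_fps_Suc[of m t "Suc k"] unfolding 3 by simp
      ultimately show ?thesis by (simp only:)
    qed
    finally show ?thesis using c by blast
  qed
qed

text \<open>
  Expanding the exponential of \<open>(1 + t) (X - t X\<^sup>2 / 4) = (1 + t) X (1 - t X / 4)\<close>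
  into powers of \<open>1 + t\<close>; all the rest is a series in \<open>t X\<close>.
\<close>

lemma count_fps_expansion:
  "count_fps (real m) t $$ n = (\<Sum>j\<le>n. (1 + t) ^ j / fact j * t ^ (n - j) *
     ((1 - fps_const (1/4) * fps_X) ^ j * kernel_fps m) $$ (n - j))"
proof -
  define g where "g = fps_const t * (fps_X :: real fps)"
  have g0: "g $$ 0 = 0" by (simp add: g_def)
  define b where "b = fps_X - fps_const (t/4) * (fps_X :: real fps) ^ 2"
  define l where "l = 1 - fps_const (1/4 :: real) * fps_X"
  have b: "b = fps_X * (l oo g)"
  proof -
    have "l oo g = 1 - fps_const (1/4) * g"
      using g0 unfolding l_def by (simp add: fps_compose_sub_distrib fps_compose_mult_distrib)
    also have "fps_const (1/4) * g = fps_const (t/4) * fps_X"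
      by (simp add: g_def mult.assoc[symmetric])
    finally show ?thesis by (simp add: b_def right_diff_distrib power2_eq_square mult.left_commute)
  qed
  have pw: "b ^ j * (kernel_fps m oo g) = fps_X ^ j * ((l ^ j * kernel_fps m) oo g)" for j
    unfolding b power_mult_distrib fps_compose_mult_distrib[OF g0] fps_compose_power[OF g0]
    by (simp add: algebra_simps)
  have "count_fps m t $$ n = (\<Sum>i\<le>n. (\<Sum>j\<le>i. (1 + t) ^ j / fact j * b ^ j $$ i) * (kernel_fps m oo g) $$ (n - i))"
    unfolding count_fps_def b_def[symmetric] g_def[symmetric] fps_mult_nth fps_compose_nth
    by (simp add: atLeast0AtMost)
  also have "\<dots> = (\<Sum>i\<le>n. (\<Sum>j\<le>n. (1 + t) ^ j / fact j * b ^ j $$ i) * (kernel_fps m oo g) $$ (n - i))"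
  proof (rule sum.cong[OF refl])
    fix i assume i: "i \<in> {..n}"
    have "(\<Sum>j\<le>i. (1 + t) ^ j / fact j * b ^ j $$ i) = (\<Sum>j\<le>n. (1 + t) ^ j / fact j * b ^ j $$ i)"
    proof (intro sum.mono_neutral_left ballI)
      fix j assume "j \<in> {..n} - {..i}"
      then have "b ^ j $$ i = 0"
        by (intro startsby_zero_power_prefix[rule_format]) (auto simp: b_def)
      then show "(1 + t) ^ j / fact j * b ^ j $$ i = 0" by simp
    qed (use i in auto)
    then show "(\<Sum>j\<le>i. (1 + t) ^ j / fact j * b ^ j $$ i) * (kernel_fps m oo g) $$ (n - i) =
      (\<Sum>j\<le>n. (1 + t) ^ j / fact j * b ^ j $$ i) * (kernel_fps m oo g) $$ (n - i)" by simp
  qed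
  also have "\<dots> = (\<Sum>j\<le>n. (1 + t) ^ j / fact j * (b ^ j * (kernel_fps m oo g)) $$ n)"
    unfolding fps_mult_nth sum_distrib_right sum_distrib_left
    by (subst sum.swap) (simp add: atLeast0AtMost mult.assoc)
  also have "\<dots> = (\<Sum>j\<le>n. (1 + t) ^ j / fact j * t ^ (n - j) * (l ^ j * kernel_fps m) $$ (n - j))"
    unfolding pw unfolding g_def by (intro sum.cong) (auto simp: fps_X_power_mult_nth fps_compose_linear)
  finally show ?thesis unfolding l_def .
qed

section \<open>Nonnegative coefficients\<close>

abbreviation lin_fps :: "real fps" where
  "lin_fps \<equiv> 1 - fps_const (1/4) * fps_X"

lemma lin_fps_mult_nth:
  "(lin_fps * f) $$ n = f $$ n - (if n = 0 then 0 else f $$ (n - 1) / 4)"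
  by (cases n) (simp_all add: left_diff_distrib mult.assoc)

lemma one_minus_X_mult_nth:
  "((1 - fps_X) * (f :: real fps)) $$ n = f $$ n - (if n = 0 then 0 else f $$ (n - 1))"
  by (cases n) (simp_all add: left_diff_distrib)

definition nonneg_upto :: "nat \<Rightarrow> real fps \<Rightarrow> bool" where
  "nonneg_upto n f \<longleftrightarrow> (\<forall>i\<le>n. 0 \<le> f $$ i)"

lemma nonneg_upto_mult: "nonneg_upto n f \<Longrightarrow> nonneg_upto n g \<Longrightarrow> nonneg_upto n (f * g)"
  unfolding nonneg_upto_def fps_mult_nth by (auto intro!: sum_nonneg)

lemma nonneg_upto_inv_sqrt: "nonneg_upto n inv_sqrt_fps"
  by (simp add: nonneg_upto_def less_imp_le[OF inv_sqrt_fps_pos])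

lemma nonneg_upto_gauss: "nonneg_upto n gauss_fps"
  by (simp add: nonneg_upto_def gauss_fps_nonneg)

text \<open>
  The logarithmic derivative of \<open>g\<close> is \<open>a - (j / 4) / (1 - X / 4)\<close>; multiplying by
  \<open>1 - X / 4\<close> gives a three-term recurrence.
\<close>

lemma lin_exp_recurrence:
  fixes a :: real and j :: nat
  defines "g \<equiv> lin_fps ^ j * fps_exp a"
  shows "4 * (real i + 1) * g $$ Suc i =
    (4 * a - real j + real i) * g $$ i - (if i = 0 then 0 else a * g $$ (i - 1))"
proof -
  define q where "q = fps_const (1/4 :: real)"
  define J where "J = fps_const (real j)"
  have ode: "lin_fps * fps_deriv g = (fps_const a * lin_fps - J * q) * g"
  proof (cases j)
    case 0
    then show ?thesis by (simp add: g_def J_def algebra_simps)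
  next
    case (Suc k)
    define L where "L = lin_fps"
    have "fps_deriv L = - q" by (simp add: L_def q_def)
    then have D: "fps_deriv (L ^ j) = J * (- q) * L ^ k"
      by (simp only: fps_deriv_power Suc J_def diff_Suc_1)
    have "fps_deriv g = L ^ j * (fps_const a * fps_exp a) + J * (- q) * L ^ k * fps_exp a"
      unfolding g_def L_def[symmetric] fps_deriv_mult fps_exp_deriv D ..
    also have "\<dots> = (fps_const a * L - J * q) * (L ^ k * fps_exp a)"
      unfolding Suc power_Suc by (simp add: algebra_simps)
    finally have dg: "fps_deriv g = (fps_const a * L - J * q) * (L ^ k * fps_exp a)" .
    show ?thesis
      unfolding dg unfolding g_def L_def[symmetric] Suc power_Suc by (simp add: algebra_simps)
  qed
  have "(lin_fps * fps_deriv g) $$ i = (real i + 1) * g $$ Suc i - real i * g $$ i / 4"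
    unfolding lin_fps_mult_nth by (cases i) (simp_all add: algebra_simps)
  moreover have "((fps_const a * lin_fps - J * q) * g) $$ i =
      a * (g $$ i - (if i = 0 then 0 else g $$ (i - 1) / 4)) - real j / 4 * g $$ i"
  proof -
    have "(fps_const a * lin_fps - J * q) * g = fps_const a * (lin_fps * g) - fps_const (real j / 4) * g"
      by (simp add: J_def q_def left_diff_distrib mult.assoc)
    then show ?thesis
      by (simp only: fps_sub_nth fps_mult_left_const_nth lin_fps_mult_nth)
  qed
  ultimately have "(real i + 1) * g $$ Suc i = real i * g $$ i / 4 +
      a * (g $$ i - (if i = 0 then 0 else g $$ (i - 1) / 4)) - real j / 4 * g $$ i"
    using ode by simp
  then show ?thesis by (cases "i = 0") (simp_all add: field_simps)
qed

text \<open>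
  The coefficients increase up to index \<open>n\<close>. If they do so up to \<open>i\<close>, the recurrence
  gives \<open>4 (i + 1) g (i + 1) \<ge> (3 a - j + i) g i\<close> with \<open>a = m - 3/2\<close>, and for
  \<open>i < n = m - j\<close> the factor on the right is at least \<open>4 (i + 1)\<close> precisely because
  \<open>2 j \<ge> 11/2\<close>.
\<close>

lemma lin_exp_increasing:
  assumes "3 \<le> j" "j + n = m"
  defines "g \<equiv> lin_fps ^ j * fps_exp (real m - 3/2)"
  shows "nonneg_upto n ((1 - fps_X) * g)"
proof -
  have g0: "g $$ 0 = 1" by (simp add: g_def fps_power_zeroth)
  have "i \<le> n \<longrightarrow> 0 \<le> g $$ i \<and> (i = 0 \<or> g $$ (i - 1) \<le> g $$ i)" for i
  proof (induction i)
    case 0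
    then show ?case using g0 by simp
  next
    case (Suc i)
    show ?case
    proof
      assume i: "Suc i \<le> n"
      with Suc.IH have IH: "0 \<le> g $$ i" "i = 0 \<or> g $$ (i - 1) \<le> g $$ i" by auto
      have a: "0 \<le> real m - 3/2" using assms(1,2) by linarith
      note rec = lin_exp_recurrence[of i j "real m - 3/2", folded g_def]
      have "4 * (real i + 1) * g $$ i \<le> 4 * (real i + 1) * g $$ Suc i"
      proof (cases "i = 0")
        case True
        have "4 \<le> 4 * (real m - 3/2) - real j" using assms(1,2) i by simp
        then show ?thesis using rec True g0 by simp
      next
        case False
        have "(real m - 3/2) * g $$ (i - 1) \<le> (real m - 3/2) * g $$ i"
          using IH False a by (intro mult_left_mono) auto
        moreover have "(4 * (real i + 1)) * g $$ i \<le> (3 * (real m - 3/2) - real j + real i) * g $$ i"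
          using assms(1,2) i IH(1) by (intro mult_right_mono) auto
        ultimately show ?thesis using rec False by (simp add: algebra_simps)
      qed
      then have "g $$ i \<le> g $$ Suc i" by simp
      then show "0 \<le> g $$ Suc i \<and> (Suc i = 0 \<or> g $$ (Suc i - 1) \<le> g $$ Suc i)"
        using IH by simp
    qed
  qed
  then show ?thesis unfolding nonneg_upto_def one_minus_X_mult_nth by auto
qed

text \<open>
  For \<open>a > 0\<close> the coefficient of index \<open>i\<close> is nonnegative for \<open>i \<le> a\<close> and negative
  afterwards, so in a product with a nonnegative series the only negative terms are those
  of the last few indices.
\<close>

definition exp_diff_fps :: "real \<Rightarrow> real fps" where
  "exp_diff_fps a = (1 - fps_X) * fps_exp a"

lemma power_over_fact_pred:
  assumes "(a :: real) \<noteq> 0"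
  shows "a ^ k / fact k = a ^ Suc k / fact (Suc k) * (real (Suc k) / a)"
proof -
  define s where "s = real (Suc k)"
  have "s \<noteq> 0" by (simp add: s_def)
  then have "a * a ^ k / (s * fact k) * (s / a) = a ^ k / fact k" using assms by simp
  moreover have "fact (Suc k) = s * fact k" unfolding s_def by (rule fact_Suc)
  ultimately show ?thesis unfolding s_def power_Suc by (simp only:)
qed

lemma exp_diff_nth:
  assumes "a \<noteq> 0"
  shows "exp_diff_fps a $$ i = a ^ i / fact i * (1 - real i / a)"
proof (cases i)
  case 0
  then show ?thesis by (simp add: exp_diff_fps_def)
next
  case (Suc k)
  have "exp_diff_fps a $$ i = a ^ i / fact i - a ^ k / fact k"
    unfolding exp_diff_fps_def one_minus_X_mult_nth by (simp add: Suc distrib_right)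
  also have "a ^ k / fact k = a ^ i / fact i * (real i / a)"
    unfolding Suc by (rule power_over_fact_pred[OF assms])
  finally show ?thesis by (simp add: right_diff_distrib)
qed

lemma exp_diff_nonneg: "0 < a \<Longrightarrow> real i \<le> a \<Longrightarrow> 0 \<le> exp_diff_fps a $$ i"
  by (subst exp_diff_nth) auto

lemma inv_sqrt_values:
  "inv_sqrt_fps $$ 0 = 1" "inv_sqrt_fps $$ 1 = 1/2" "inv_sqrt_fps $$ 2 = 3/8"
  "inv_sqrt_fps $$ 3 = 5/16" "inv_sqrt_fps $$ 4 = 35/128" "inv_sqrt_fps $$ 5 = 63/256"
  by (simp_all add: inv_sqrt_fps_def lessThan_nat_numeral lessThan_Suc numeral_eq_Suc)

lemma lin_inv_sqrt_nonneg: "nonneg_upto n (lin_fps ^ j * inv_sqrt_fps)" if "j \<le> 2"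
proof -
  have half: "inv_sqrt_fps $$ l / 2 \<le> inv_sqrt_fps $$ Suc l" for l
    unfolding inv_sqrt_fps_nth_Suc using inv_sqrt_fps_pos[of l] by (simp add: field_simps)
  have 1: "0 \<le> (lin_fps * inv_sqrt_fps) $$ i" for i
    unfolding lin_fps_mult_nth using half[of "i - 1"] inv_sqrt_fps_pos[of "i - 1"]
    by (cases i) (auto simp: inv_sqrt_fps_nth_0)
  have 2: "0 \<le> (lin_fps * (lin_fps * inv_sqrt_fps)) $$ i" for i
  proof -
    consider "i = 0" | "i = 1" | k where "i = Suc (Suc k)" by (cases i; cases "i - 1"; force)
    then show ?thesis
    proof cases
      case 3
      then show ?thesis using half[of "Suc k"] inv_sqrt_fps_pos[of k] unfolding lin_fps_mult_nth
        by simp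
    qed (simp_all add: lin_fps_mult_nth inv_sqrt_fps_nth_0 inv_sqrt_fps_nth_Suc)
  qed
  have "j = 0 \<or> j = 1 \<or> j = 2" using that by auto
  then show ?thesis
    using 1 2 nonneg_upto_inv_sqrt[of n] unfolding nonneg_upto_def
    by (auto simp: power2_eq_square mult.assoc)
qed

text \<open>
  Only the last coefficients of \<open>e\<close> may be negative, so the remaining terms of the
  convolution can be dropped in a lower bound.
\<close>

lemma mult_nth_ge_top:
  assumes "k \<le> n" "\<And>l. l \<le> n \<Longrightarrow> 0 \<le> s $$ l" "\<And>i. i < n - k \<Longrightarrow> 0 \<le> (e :: real fps) $$ i"
  shows "(\<Sum>l\<le>k. s $$ l * e $$ (n - l)) \<le> (s * e) $$ n"
proof -
  have "(\<Sum>l\<le>k. s $$ l * e $$ (n - l)) \<le> (\<Sum>l\<le>n. s $$ l * e $$ (n - l))"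
    using assms by (intro sum_mono2) auto
  then show ?thesis by (simp add: fps_mult_nth atLeast0AtMost)
qed

text \<open>
  Here the index exceeds \<open>a\<close> by \<open>1/2\<close>, so a single negative term occurs. In units of the
  last coefficient of \<open>exp (a X)\<close> divided by \<open>a\<close> it is \<open>-1/2\<close>, and for \<open>s\<close> as small as
  allowed the next two terms contribute about \<open>1/8\<close> and \<open>3/8\<close>; they cancel it to first
  order, and the second order term is positive.
\<close>

lemma exp_diff_product_half:
  assumes "1 \<le> k" "a = real k + 1/2" and s: "\<And>l. 0 \<le> s $$ l"
    and "s $$ 0 = 1" "s $$ 1 \<ge> 1/4" "s $$ 2 \<ge> 1/4"
  shows "0 \<le> (s * exp_diff_fps a) $$ (k + 1)"
proof -
  let ?n = "k + 1"
  have a: "0 < a" using assms(2) by simp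
  have "(\<Sum>l\<le>2. s $$ l * exp_diff_fps a $$ (?n - l)) \<le> (s * exp_diff_fps a) $$ ?n"
    using assms a by (intro mult_nth_ge_top exp_diff_nonneg) auto
  moreover have "(\<Sum>l\<le>2. s $$ l * exp_diff_fps a $$ (?n - l)) =
     exp_diff_fps a $$ ?n + s $$ 1 * exp_diff_fps a $$ k + s $$ 2 * exp_diff_fps a $$ (k - 1)"
    using assms by (simp add: atMost_nat_numeral atMost_Suc numeral_2_eq_2)
  moreover have "1/4 * exp_diff_fps a $$ k \<le> s $$ 1 * exp_diff_fps a $$ k" "1/4 * exp_diff_fps a $$ (k - 1) \<le> s $$ 2 * exp_diff_fps a $$ (k - 1)"
    using assms by (intro mult_right_mono exp_diff_nonneg; simp)+
  moreover have "0 \<le> exp_diff_fps a $$ ?n + 1/4 * exp_diff_fps a $$ k + 1/4 * exp_diff_fps a $$ (k - 1)"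
  proof -
    obtain q where q: "k = Suc q" using assms(1) by (cases k) auto
    define F where "F = (\<lambda>i. a ^ i / fact i)"
    define r where "r = 1 / a"
    have r: "real k = a - 1/2" "a * r = 1" "0 \<le> r" "r \<le> 2/3"
      using a assms(1,2) by (simp_all add: r_def field_simps)
    have pos: "0 \<le> F ?n" using a by (simp add: F_def)
    have F: "F i = F (Suc i) * (real (Suc i) * r)" for i
      using power_over_fact_pred[of a i] a unfolding F_def r_def by simp
    have F1: "F k = F ?n * (1 + r / 2)" using F[of k] r(1,2) by (simp add: algebra_simps)
    have "F (k - 1) = F k * (real k * r)" using F[of q] q by simp
    then have F2: "F (k - 1) = F k * (1 - r / 2)" unfolding r(1) using r(2) by (simp add: algebra_simps)
    have e: "exp_diff_fps a $$ i = F i * (1 - real i * r)" for i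
      using exp_diff_nth[of a i] a by (simp add: F_def r_def)
    have "exp_diff_fps a $$ ?n = F ?n * (- r / 2)" "exp_diff_fps a $$ k = F k * (r / 2)"
      "exp_diff_fps a $$ (k - 1) = F (k - 1) * (3/2 * r)"
    proof -
      have kr: "real k * r = 1 - r / 2" unfolding r(1) using r(2) by (simp add: algebra_simps)
      have "real ?n * r = 1 + r / 2" "real (k - 1) * r = 1 - 3/2 * r"
        using kr assms(1) by (simp_all add: of_nat_diff algebra_simps)
      then show "exp_diff_fps a $$ ?n = F ?n * (- r / 2)" "exp_diff_fps a $$ k = F k * (r / 2)"
        "exp_diff_fps a $$ (k - 1) = F (k - 1) * (3/2 * r)"
        unfolding e kr by simp_all
    qed
    then have "exp_diff_fps a $$ ?n + 1/4 * exp_diff_fps a $$ k + 1/4 * exp_diff_fps a $$ (k - 1) =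
      F ?n * r\<^sup>2 / 16 * (1 - 3/2 * r)"
      unfolding F2 F1 by (simp add: field_simps power2_eq_square)
    also have "0 \<le> F ?n * r\<^sup>2 / 16 * (1 - 3/2 * r)"
      using pos r by (intro mult_nonneg_nonneg) auto
    finally show ?thesis .
  qed
  ultimately show ?thesis by linarith
qed

lemma kernel_fps_recurrence:
  "(real i + 1) * kernel_fps m $$ Suc i = (m - 2 + real i) * kernel_fps m $$ i
     - (if i = 0 then 0 else (m - 2) * kernel_fps m $$ (i - 1))
     - (if i < 2 then 0 else kernel_fps m $$ (i - 2) / 2)"
proof -
  have "((1 - fps_X) * fps_deriv (kernel_fps m)) $$ i = (real i + 1) * kernel_fps m $$ Suc i - real i * kernel_fps m $$ i"
    unfolding one_minus_X_mult_nth by (cases i) (simp_all add: add.commute)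
  moreover have "(kernel_fps m * (fps_const (m - 2) * (1 - fps_X) - fps_const (1/2) * fps_X ^ 2)) $$ i =
     (m - 2) * (kernel_fps m $$ i - (if i = 0 then 0 else kernel_fps m $$ (i - 1))) -
     (if i < 2 then 0 else kernel_fps m $$ (i - 2) / 2)"
  proof -
    have "kernel_fps m * (fps_const (m - 2) * (1 - fps_X) - fps_const (1/2) * fps_X ^ 2) =
      fps_const (m - 2) * ((1 - fps_X) * kernel_fps m) - fps_const (1/2) * (fps_X ^ 2 * kernel_fps m)"
      by (simp add: algebra_simps)
    then show ?thesis
      by (simp only: fps_sub_nth fps_mult_left_const_nth one_minus_X_mult_nth fps_X_power_mult_nth) simp
  qed
  ultimately have "(real i + 1) * kernel_fps m $$ Suc i - real i * kernel_fps m $$ i =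
     (m - 2) * (kernel_fps m $$ i - (if i = 0 then 0 else kernel_fps m $$ (i - 1))) -
     (if i < 2 then 0 else kernel_fps m $$ (i - 2) / 2)"
    by (simp only: kernel_fps_ODE)
  then show ?thesis by (cases "i = 0") (simp_all add: algebra_simps)
qed

lemma kernel_fps_0: "kernel_fps m $$ 0 = 1"
  by (simp add: kernel_fps_def inv_sqrt_fps_nth_0 gauss_fps_def)

text \<open>
  The cases to which the estimate by six terms does not apply. The bound is attained: for
  \<open>m = 3\<close> the coefficient is \<open>0\<close>, because the three-dimensional polytope has no interior
  lattice point.
\<close>

lemma kernel_fps_small: "3 \<le> m \<Longrightarrow> m \<le> 6 \<Longrightarrow> 0 \<le> kernel_fps (real m) $$ m"
proof -
  assume m: "3 \<le> m" "m \<le> 6"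
  define b where "b = real m - 2"
  let ?k = "\<lambda>i. kernel_fps (real m) $$ i"
  note r = kernel_fps_recurrence[of _ "real m", folded b_def]
  have k1: "?k 1 = b" using r[of 0] by (simp add: kernel_fps_0)
  have k2: "?k 2 = b\<^sup>2 / 2"
    using r[of 1] k1 by (simp add: kernel_fps_0 numeral_2_eq_2 power2_eq_square algebra_simps)
  have k3: "3 * ?k 3 = (b + 2) * ?k 2 - b * ?k 1 - 1/2"
    using r[of 2] by (simp add: kernel_fps_0 numeral_3_eq_3)
  have k4: "4 * ?k 4 = (b + 3) * ?k 3 - b * ?k 2 - ?k 1 / 2"
    using r[of 3] by (simp add: eval_nat_numeral)
  have k5: "5 * ?k 5 = (b + 4) * ?k 4 - b * ?k 3 - ?k 2 / 2"
    using r[of 4] by (simp add: eval_nat_numeral)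
  have k6: "6 * ?k 6 = (b + 5) * ?k 5 - b * ?k 4 - ?k 3 / 2"
    using r[of 5] by (simp add: eval_nat_numeral)
  consider "m = 3" | "m = 4" | "m = 5" | "m = 6" using m by linarith
  then show ?thesis
    by cases (use k1 k2 k3 k4 k5 k6 in \<open>simp_all add: b_def power2_eq_square\<close>)
qed

text \<open>
  Now the index exceeds \<open>a\<close> by \<open>3/2\<close>, and there are two negative terms. Six terms are
  enough to outweigh them: to first order in \<open>r = 1 / a\<close> their sum is \<open>231/512\<close>, and the
  exact sum is a polynomial in \<open>r\<close> that is still positive at \<open>r = 2/11\<close>, the value for
  \<open>m = 7\<close>.
\<close>

lemma exp_diff_product_top:
  assumes "7 \<le> m"
  shows "0 \<le> (inv_sqrt_fps * exp_diff_fps (real m - 3/2)) $$ m"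
proof -
  define a where "a = real m - 3/2"
  have a: "0 < a" using assms by (simp add: a_def)
  obtain q where q: "m = q + 5" using that[of "m - 5"] assms by simp
  have "(\<Sum>l\<le>5. inv_sqrt_fps $$ l * exp_diff_fps a $$ (m - l)) \<le> (inv_sqrt_fps * exp_diff_fps a) $$ m"
    using assms a inv_sqrt_fps_pos
    by (intro mult_nth_ge_top exp_diff_nonneg) (auto simp: a_def less_imp_le)
  moreover have "(\<Sum>l\<le>5. inv_sqrt_fps $$ l * exp_diff_fps a $$ (m - l)) =
     exp_diff_fps a $$ (q+5) + exp_diff_fps a $$ (q+4) / 2 + 3/8 * exp_diff_fps a $$ (q+3) + 5/16 * exp_diff_fps a $$ (q+2)
     + 35/128 * exp_diff_fps a $$ (q+1) + 63/256 * exp_diff_fps a $$ q"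
  proof -
    have "(\<Sum>l\<le>5. f l) = f 0 + f 1 + f 2 + f 3 + f 4 + f 5" for f :: "nat \<Rightarrow> real"
      by (simp add: eval_nat_numeral)
    then show ?thesis unfolding q by (simp add: inv_sqrt_values inv_sqrt_values(2)[simplified] add.commute)
  qed
  moreover have "0 \<le> exp_diff_fps a $$ (q+5) + exp_diff_fps a $$ (q+4) / 2 + 3/8 * exp_diff_fps a $$ (q+3) + 5/16 * exp_diff_fps a $$ (q+2)
     + 35/128 * exp_diff_fps a $$ (q+1) + 63/256 * exp_diff_fps a $$ q"
  proof -
    define F where "F = (\<lambda>i. a ^ i / fact i)"
    define r where "r = 1 / a"
    have r: "real q = a - 7/2" "a * r = 1" "0 \<le> r" "r \<le> 2/11"
      using a assms q by (simp_all add: r_def a_def field_simps)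
    have pos: "0 \<le> F (q+5)" using a by (simp add: F_def)
    have F: "F k = F (Suc k) * (real (Suc k) * r)" for k
      using power_over_fact_pred[of a k] a unfolding F_def r_def by simp
    have F4: "F (q+4) = F (q+5) * (1 + 3/2 * r)" using F[of "q+4"] r(1,2) by (simp add: algebra_simps)
    have F3: "F (q+3) = F (q+4) * (1 + 1/2 * r)" using F[of "q+3"] r(1,2) by (simp add: algebra_simps)
    have F2: "F (q+2) = F (q+3) * (1 - 1/2 * r)" using F[of "q+2"] r(1,2) by (simp add: algebra_simps eval_nat_numeral)
    have F1: "F (q+1) = F (q+2) * (1 - 3/2 * r)" using F[of "q+1"] r(1,2) by (simp add: algebra_simps)
    have F0: "F q = F (q+1) * (1 - 5/2 * r)" using F[of q] r(1,2) by (simp add: algebra_simps)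
    have e: "exp_diff_fps a $$ i = F i * (1 - real i * r)" for i
      using exp_diff_nth[of a i] a by (simp add: F_def r_def)
    have e': "exp_diff_fps a $$ (q+5) = F (q+5) * (- 3/2 * r)" "exp_diff_fps a $$ (q+4) = F (q+4) * (- 1/2 * r)"
      "exp_diff_fps a $$ (q+3) = F (q+3) * (1/2 * r)" "exp_diff_fps a $$ (q+2) = F (q+2) * (3/2 * r)"
      "exp_diff_fps a $$ (q+1) = F (q+1) * (5/2 * r)" "exp_diff_fps a $$ q = F q * (7/2 * r)"
    proof -
      have "real q * r = 1 - 7/2 * r" unfolding r(1) using r(2) by (simp add: algebra_simps)
      then show "exp_diff_fps a $$ (q+5) = F (q+5) * (- 3/2 * r)" "exp_diff_fps a $$ (q+4) = F (q+4) * (- 1/2 * r)"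
        "exp_diff_fps a $$ (q+3) = F (q+3) * (1/2 * r)" "exp_diff_fps a $$ (q+2) = F (q+2) * (3/2 * r)"
        "exp_diff_fps a $$ (q+1) = F (q+1) * (5/2 * r)" "exp_diff_fps a $$ q = F q * (7/2 * r)"
        unfolding e of_nat_add distrib_right by simp_all
    qed
    have "exp_diff_fps a $$ (q+5) + exp_diff_fps a $$ (q+4) / 2 + 3/8 * exp_diff_fps a $$ (q+3) + 5/16 * exp_diff_fps a $$ (q+2)
     + 35/128 * exp_diff_fps a $$ (q+1) + 63/256 * exp_diff_fps a $$ q =
      F (q+5) * r * (231/512 - 1485/1024 * r - 3931/1024 * r^2 + 10665/2048 * r^3 + 7119/8192 * r^4 - 19845/16384 * r^5)"
      unfolding e' F0 F1 F2 F3 F4 by (simp add: field_simps eval_nat_numeral)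
    also have "0 \<le> \<dots>"
    proof -
      have "r ^ 5 \<le> r ^ 3" using r by (intro power_decreasing) auto
      moreover have "0 \<le> r ^ 3" "0 \<le> r ^ 4" using r(3) by (rule zero_le_power)+
      moreover have "r ^ 2 \<le> (2/11) ^ 2" using r by (intro power_mono) auto
      then have "r ^ 2 \<le> 4/121" by (simp add: power2_eq_square)
      ultimately have "0 \<le> 231/512 - 1485/1024 * r - 3931/1024 * r^2 + 10665/2048 * r^3 + 7119/8192 * r^4 - 19845/16384 * r^5"
        using r(4) by linarith
      then show ?thesis using pos r by (intro mult_nonneg_nonneg) auto
    qed
    finally show ?thesis .
  qed
  ultimately show ?thesis by (simp add: a_def)
qed

text \<open>
  The factor \<open>1 - X\<close> hidden in the square root is the only source of negative
  coefficients besides \<open>1 - X / 4\<close>. For \<open>j \<ge> 3\<close> it is combined with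
  \<open>(1 - X / 4) ^ j exp (a X)\<close>, whose coefficients increase. For \<open>j \<le> 2\<close> the powers of
  \<open>1 - X / 4\<close> are absorbed by \<open>1 / sqrt (1 - X)\<close>, whose coefficients decrease slowly, and
  \<open>(1 - X) exp (a X)\<close> has at most \<open>2 - j\<close> negative coefficients in the relevant range.
\<close>

theorem kernel_coefficient_nonneg:
  assumes "3 \<le> m" "j + n = m"
  shows "0 \<le> (lin_fps ^ j * kernel_fps (real m)) $$ n"
proof (cases "j = 0 \<and> m \<le> 6")
  case True
  then show ?thesis using kernel_fps_small[of m] assms by simp
next
  case False
  define a where "a = real m - 3/2"
  have a: "0 < a" using assms by (simp add: a_def)
  have eq: "lin_fps ^ j * kernel_fps (real m) =
    (lin_fps ^ j * inv_sqrt_fps * exp_diff_fps a) * gauss_fps"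
    by (simp add: kernel_fps_def exp_diff_fps_def a_def mult_ac)
  have "nonneg_upto n (lin_fps ^ j * inv_sqrt_fps * exp_diff_fps a)"
  proof (cases "3 \<le> j")
    case True
    have "lin_fps ^ j * inv_sqrt_fps * exp_diff_fps a = inv_sqrt_fps * ((1 - fps_X) * (lin_fps ^ j * fps_exp a))"
      by (simp add: exp_diff_fps_def mult_ac)
    then show ?thesis
      using nonneg_upto_mult[OF nonneg_upto_inv_sqrt lin_exp_increasing[OF True assms(2)]]
      by (simp only: a_def)
  next
    case False
    then have j: "j \<le> 2" by simp
    define s where "s = lin_fps ^ j * inv_sqrt_fps"
    have s: "0 \<le> s $$ l" for l
      using lin_inv_sqrt_nonneg[OF j, of l] unfolding nonneg_upto_def s_def by blast
    have low: "0 \<le> (s * exp_diff_fps a) $$ i" if "i \<le> m - 2" for i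
    proof -
      have "nonneg_upto i (exp_diff_fps a)"
        unfolding nonneg_upto_def using that assms(1) a by (auto intro!: exp_diff_nonneg simp: a_def)
      moreover have "nonneg_upto i s" using s by (simp add: nonneg_upto_def)
      ultimately show ?thesis using nonneg_upto_mult[of i s "exp_diff_fps a"] by (simp add: nonneg_upto_def)
    qed
    have mid: "0 \<le> (s * exp_diff_fps a) $$ (m - 1)" if "j \<le> 1"
    proof -
      have "s $$ 0 = 1 \<and> 1/4 \<le> s $$ 1 \<and> 1/4 \<le> s $$ 2"
        using that inv_sqrt_values(1-3) unfolding s_def
        by (cases j) (simp_all add: lin_fps_mult_nth)
      then show ?thesis
        using exp_diff_product_half[of "m - 2" a s] s assms(1) by (simp add: a_def of_nat_diff Suc_diff_Suc numeral_2_eq_2)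
    qed
    have top: "0 \<le> (s * exp_diff_fps a) $$ m" if "j = 0"
      using exp_diff_product_top[of m] that \<open>\<not> (j = 0 \<and> m \<le> 6)\<close> by (simp add: s_def a_def)
    show ?thesis
      unfolding nonneg_upto_def s_def[symmetric]
    proof (intro allI impI)
      fix i assume i: "i \<le> n"
      consider "i \<le> m - 2" | "i = m - 1" "j \<le> 1" | "i = m" "j = 0"
        using i assms by linarith
      then show "0 \<le> (s * exp_diff_fps a) $$ i" by cases (use low mid top in auto)
    qed
  qed
  then have "nonneg_upto n (lin_fps ^ j * kernel_fps (real m))"
    unfolding eq by (rule nonneg_upto_mult[OF _ nonneg_upto_gauss])
  then show ?thesis by (simp add: nonneg_upto_def)
qed

section \<open>Magic positivity\<close>

text \<open>
  The quotient of factorials combines the factor \<open>m!\<close> of the generating function with the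
  denominator of \<open>(1 + t) ^ (m - i)\<close> in the exponential series.
\<close>

definition ehrhart_coeff :: "nat \<Rightarrow> nat \<Rightarrow> real" where
  "ehrhart_coeff m i = fact m / fact (m - i) * (lin_fps ^ (m - i) * kernel_fps (real m)) $$ i"

definition ehrhart_poly :: "nat \<Rightarrow> real poly" where
  "ehrhart_poly m = (\<Sum>i\<le>m. smult (ehrhart_coeff m i) ([:0, 1:] ^ i * [:1, 1:] ^ (m - i)))"

lemma poly_ehrhart_poly:
  "poly (ehrhart_poly m) t = fact m * count_fps (real m) t $$ m"
proof -
  have "poly (ehrhart_poly m) t = (\<Sum>i\<le>m. ehrhart_coeff m i * (t ^ i * (1 + t) ^ (m - i)))"
    by (simp add: ehrhart_poly_def poly_sum poly_power)
  also have "\<dots> = (\<Sum>j\<le>m. ehrhart_coeff m (m - j) * (t ^ (m - j) * (1 + t) ^ (m - (m - j))))"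
    using sum.nat_diff_reindex[of "\<lambda>i. ehrhart_coeff m i * (t ^ i * (1 + t) ^ (m - i))" "Suc m"]
    by (simp add: lessThan_Suc_atMost)
  also have "\<dots> = fact m * count_fps (real m) t $$ m"
    unfolding count_fps_expansion sum_distrib_left
    by (intro sum.cong refl) (simp add: ehrhart_coeff_def)
  finally show ?thesis .
qed

theorem corollary1p5:
  assumes "CARD('n::finite) \<ge> 3"
  shows "\<exists>p. is_ehrhart_polynomial (parking_function_polytope :: (real ^ 'n) set) p \<and>
             magic_positive (nat (aff_dim (parking_function_polytope :: (real ^ 'n) set))) p"
proof (intro exI conjI)
  let ?m = "CARD('n)"
  show "is_ehrhart_polynomial (parking_function_polytope :: (real ^ 'n) set) (ehrhart_poly ?m)"
    unfolding is_ehrhart_polynomial_def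
  proof (intro allI impI)
    fix t :: nat assume t: "1 \<le> t"
    have "real (card (demands (int t) (UNIV :: 'n set) 0)) = lattice_count (real t) (real ?m * real t) ?m"
      using card_demands_and_excess_sum(1)[of "UNIV :: 'n set" "int t" 0 ?m] by simp
    then show "poly (ehrhart_poly ?m) (real t) =
        real (card ((\<lambda>x. real t *\<^sub>R x) ` (parking_function_polytope :: (real ^ 'n) set) \<inter> integer_lattice))"
      unfolding card_dilated_lattice_points[OF t] poly_ehrhart_poly
      using lattice_count_eq_count_fps[of "real t" "real ?m" ?m] by simp
  qed
  have "0 \<le> ehrhart_coeff ?m i" if "i \<le> ?m" for i
    unfolding ehrhart_coeff_def using assms that
    by (intro mult_nonneg_nonneg kernel_coefficient_nonneg) auto
  then show "magic_positive (nat (aff_dim (parking_function_polytope :: (real ^ 'n) set))) (ehrhart_poly ?m)"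
    unfolding magic_positive_def aff_dim_parking_function_polytope[OF assms] nat_int
    by (intro exI[of _ "ehrhart_coeff ?m"]) (simp add: ehrhart_poly_def)
qed

end
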